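(* Let $\theta=\frac12(\mathrm{id}-\tau):K\hat\pi\to K\hat\pi$. Then the image $\theta K\hat\pi\subset K\hat\pi$ is a Lie subalgebra of the Goldman Lie algebra $K\hat\pi$ of $\tilde F$.
   Context: $K$ is a commutative associative ring containing $\mathbb{Q}$. $F$ is a compact connected non-orientable surface with non-empty boundary, $p:\tilde F\to F$ is its orientation (double) cover, $\tau:\tilde F\to\tilde F$ is the nontrivial covering transformation, and an orientation of $\tilde F$ is fixed. $\hat\pi$ is the set of free homotopy classes of oriented loops in $\tilde F$, and $K\hat\pi$ is the free $K$-module with basis $\hat\pi$. $K\hat\pi$ is the Goldman Lie algebra of the oriented surface $\tilde F$: for $\alpha,\beta\in\hat\pi$ represented by loops in general position, $[\alpha,\beta]=\sum_{q\in\alpha\cap\beta}\varepsilon(q;\alpha,\beta)\,|\alpha_q\beta_q|$, where $\varepsilon(q;\alpha,\beta)=\pm1$ is the local intersection number, $\alpha_q,\beta_q$ are the loops based at $q$, and $|\cdot|$ denotes the free homotopy class. The covering transformation $\tau$ acts on $\hat\pi$ and, by linear extension, on $K\hat\pi$. *)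

theory Defs
  imports
    "HOL-Analysis.Analysis"
    "HOL-Complex_Analysis.Complex_Analysis"
    "HOL-Library.Poly_Mapping"
begin

section \<open>Topological surfaces with boundary\<close>

text \<open>Surfaces are subspaces \<open>S\<close> of a topological space, locally modelled on the closed upper
  half plane. A chart is a pair \<open>(U, \<phi>)\<close>; only the values of \<open>\<phi>\<close> on \<open>U\<close> matter.
  By invariance of domain, a point \<open>x\<close> is an interior point of the surface iff
  \<open>Im (\<phi> x) > 0\<close> in one, equivalently every, chart around \<open>x\<close>.\<close>

definition half_plane :: "complex set" where
  "half_plane = {z. Im z \<ge> 0}"

definition charts :: "'a::topological_space set \<Rightarrow> ('a set \<times> ('a \<Rightarrow> complex)) set" where
  "charts S = {(U, \<phi>). openin (top_of_set S) U \<and> openin (top_of_set half_plane) (\<phi> ` U)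
                      \<and> (\<exists>\<psi>. homeomorphism U (\<phi> ` U) \<phi> \<psi>)}"

definition surface :: "'a::topological_space set \<Rightarrow> bool" where
  "surface S \<longleftrightarrow> Hausdorff_space (top_of_set S) \<and> second_countable (top_of_set S)
                \<and> (\<forall>x\<in>S. \<exists>(U, \<phi>)\<in>charts S. x \<in> U)"

definition surface_boundary :: "'a::topological_space set \<Rightarrow> 'a set" where
  "surface_boundary S = {x\<in>S. \<exists>(U, \<phi>)\<in>charts S. x \<in> U \<and> Im (\<phi> x) = 0}"


section \<open>Orientations\<close>

text \<open>A local homeomorphism \<open>h\<close> of the plane preserves the orientation at \<open>z\<close> (local degree \<open>1\<close>)
  if it preserves the winding numbers about \<open>z\<close> of all sufficiently small loops.\<close>

definition orientation_preserving_at :: "(complex \<Rightarrow> complex) \<Rightarrow> complex \<Rightarrow> bool" where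
  "orientation_preserving_at h z \<longleftrightarrow>
     (\<exists>r>0. \<forall>\<gamma>. path \<gamma> \<and> pathfinish \<gamma> = pathstart \<gamma> \<and> path_image \<gamma> \<subseteq> ball z r - {z}
              \<longrightarrow> winding_number (h \<circ> \<gamma>) (h z) = winding_number \<gamma> z)"

text \<open>Two charts around \<open>x\<close> define the same local orientation at \<open>x\<close> if the coordinate change
  preserves the orientation at all interior points near \<open>x\<close>. Testing at interior points only
  gives a definition that also applies when \<open>x\<close> lies on the boundary.\<close>

definition same_orientation_at ::
    "'a::topological_space set \<Rightarrow> 'a \<Rightarrow> 'a set \<times> ('a \<Rightarrow> complex) \<Rightarrow> 'a set \<times> ('a \<Rightarrow> complex) \<Rightarrow> bool"
  where
  "same_orientation_at S x = (\<lambda>(U, \<phi>) (V, \<psi>).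
     \<exists>W. openin (top_of_set S) W \<and> x \<in> W
       \<and> (\<forall>y \<in> W \<inter> U \<inter> V. Im (\<phi> y) > 0 \<longrightarrow>
             orientation_preserving_at (\<psi> \<circ> inv_into U \<phi>) (\<phi> y)))"

definition charts_at :: "'a::topological_space set \<Rightarrow> 'a \<Rightarrow> ('a set \<times> ('a \<Rightarrow> complex)) set" where
  "charts_at S x = {c \<in> charts S. x \<in> fst c}"

text \<open>A local orientation at \<open>x\<close> is an equivalence class of charts around \<open>x\<close>; on a surface there
  are exactly two of them at each point.\<close>

type_synonym 'a local_orientation = "('a set \<times> ('a \<Rightarrow> complex)) set"

definition local_orientations :: "'a::topological_space set \<Rightarrow> 'a \<Rightarrow> 'a local_orientation set" where
  "local_orientations S x =
     charts_at S x // {(c, d). c \<in> charts_at S x \<and> d \<in> charts_at S x \<and> same_orientation_at S x c d}"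

definition is_orientation ::
    "'a::topological_space set \<Rightarrow> ('a \<Rightarrow> 'a local_orientation) \<Rightarrow> bool" where
  "is_orientation S \<mu> \<longleftrightarrow>
     (\<forall>x\<in>S. \<mu> x \<in> local_orientations S x \<and> (\<exists>(U, \<phi>)\<in>\<mu> x. \<forall>y\<in>U. (U, \<phi>) \<in> \<mu> y))"

definition orientable :: "'a::topological_space set \<Rightarrow> bool" where
  "orientable S \<longleftrightarrow> (\<exists>\<mu>. is_orientation S \<mu>)"


section \<open>The orientation cover\<close>

text \<open>The points of the orientation cover of \<open>F\<close> are the pairs \<open>(x, \<omega>)\<close> of a point \<open>x\<close> of \<open>F\<close> and a
  local orientation \<open>\<omega>\<close> at \<open>x\<close>, topologised so that for every chart \<open>(U, \<phi>)\<close> the pairs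
  \<open>(x, class of (U, \<phi>) at x)\<close>, for \<open>x\<close> in \<open>U\<close>, form an open sheet over \<open>U\<close>. The definition says that
  a covering space \<open>p : Ft \<rightarrow> F\<close> is this one, the point \<open>y\<close> of \<open>Ft\<close> corresponding to
  \<open>(p y, ori y)\<close>; the last clause determines the topology because \<open>p\<close> is a local homeomorphism.\<close>

definition orientation_cover ::
    "'b::topological_space set \<Rightarrow> ('b \<Rightarrow> 'a) \<Rightarrow> 'a::topological_space set \<Rightarrow> bool" where
  "orientation_cover Ft p F \<longleftrightarrow> covering_space Ft p F \<and>
     (\<exists>ori. bij_betw (\<lambda>y. (p y, ori y)) Ft (SIGMA x:F. local_orientations F x)
          \<and> (\<forall>(U, \<phi>)\<in>charts F. openin (top_of_set Ft) {y\<in>Ft. (U, \<phi>) \<in> ori y}))"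

definition covering_transformation ::
    "'b::topological_space set \<Rightarrow> ('b \<Rightarrow> 'a) \<Rightarrow> ('b \<Rightarrow> 'b) \<Rightarrow> bool" where
  "covering_transformation Ft p \<tau> \<longleftrightarrow>
     (\<exists>\<sigma>. homeomorphism Ft Ft \<tau> \<sigma>) \<and> (\<forall>y\<in>Ft. p (\<tau> y) = p y)"


section \<open>Free homotopy classes of loops\<close>

definition loops :: "'a::topological_space set \<Rightarrow> (real \<Rightarrow> 'a) set" where
  "loops S = {\<gamma>. path \<gamma> \<and> path_image \<gamma> \<subseteq> S \<and> pathfinish \<gamma> = pathstart \<gamma>}"

definition free_homotopy :: "'a::topological_space set \<Rightarrow> ((real \<Rightarrow> 'a) \<times> (real \<Rightarrow> 'a)) set" where
  "free_homotopy S = {(\<gamma>, \<delta>). homotopic_loops S \<gamma> \<delta>}"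

definition free_class :: "'a::topological_space set \<Rightarrow> (real \<Rightarrow> 'a) \<Rightarrow> (real \<Rightarrow> 'a) set" where
  "free_class S \<gamma> = free_homotopy S `` {\<gamma>}"

definition pi_hat :: "'a::topological_space set \<Rightarrow> (real \<Rightarrow> 'a) set set" where
  "pi_hat S = loops S // free_homotopy S"

text \<open>The map induced on free homotopy classes by a self-map \<open>f\<close> of \<open>S\<close>. The saturation under
  \<open>free_homotopy\<close> is needed because a loop is a function on all of \<open>real\<close>, of which only the
  restriction to \<open>{0..1}\<close> is significant.\<close>

definition push_class ::
    "'a::topological_space set \<Rightarrow> ('a \<Rightarrow> 'a) \<Rightarrow> (real \<Rightarrow> 'a) set \<Rightarrow> (real \<Rightarrow> 'a) set" where
  "push_class S f \<alpha> = free_homotopy S `` ((\<lambda>\<gamma>. f \<circ> \<gamma>) ` \<alpha>)"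


section \<open>Free modules\<close>

definition fscale :: "'k::comm_ring_1 \<Rightarrow> ('b \<Rightarrow>\<^sub>0 'k) \<Rightarrow> ('b \<Rightarrow>\<^sub>0 'k)" where
  "fscale c = Poly_Mapping.map (\<lambda>d. c * d)"

lemma lookup_fscale: "Poly_Mapping.lookup (fscale c x) b = c * Poly_Mapping.lookup x b"
  unfolding fscale_def by transfer (simp add: when_def)

interpretation free_module: module fscale
  by unfold_locales (auto intro!: poly_mapping_eqI simp: lookup_fscale Poly_Mapping.lookup_add algebra_simps)

definition free_module_on :: "'b set \<Rightarrow> ('b \<Rightarrow>\<^sub>0 'k::comm_ring_1) set" where
  "free_module_on B = {x. Poly_Mapping.keys x \<subseteq> B}"

definition extend_linear ::
    "('b \<Rightarrow> ('c \<Rightarrow>\<^sub>0 'k)) \<Rightarrow> ('b \<Rightarrow>\<^sub>0 'k::comm_ring_1) \<Rightarrow> ('c \<Rightarrow>\<^sub>0 'k)" where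
  "extend_linear f x = (\<Sum>b\<in>Poly_Mapping.keys x. fscale (Poly_Mapping.lookup x b) (f b))"

definition lie_subalgebra ::
    "(('b \<Rightarrow>\<^sub>0 'k) \<Rightarrow> ('b \<Rightarrow>\<^sub>0 'k) \<Rightarrow> ('b \<Rightarrow>\<^sub>0 'k)) \<Rightarrow> ('b \<Rightarrow>\<^sub>0 'k::comm_ring_1) set
      \<Rightarrow> ('b \<Rightarrow>\<^sub>0 'k) set \<Rightarrow> bool" where
  "lie_subalgebra br L N \<longleftrightarrow>
     N \<subseteq> L \<and> free_module.subspace N \<and> (\<forall>x\<in>N. \<forall>y\<in>N. br x y \<in> N)"


section \<open>The Goldman bracket\<close>

text \<open>\<open>param a q\<close> is the parameter in \<open>{0..<1}\<close> at which the loop \<open>a\<close> passes through \<open>q\<close>; it is only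
  used where that parameter is unique. \<open>based_at a q\<close> is the loop \<open>a\<close> based at \<open>q\<close>.\<close>

definition param :: "(real \<Rightarrow> 'a) \<Rightarrow> 'a \<Rightarrow> real" where
  "param a q = (THE s. s \<in> {0..<1} \<and> a s = q)"

definition based_at :: "(real \<Rightarrow> 'a::topological_space) \<Rightarrow> 'a \<Rightarrow> (real \<Rightarrow> 'a)" where
  "based_at a q = shiftpath (param a q) a"

text \<open>Near the parameter \<open>s\<close>, the loop \<open>a\<close> is, in the chart \<open>(U, \<phi>)\<close>, a straight line with velocity
  \<open>v\<close>. The function \<open>frac\<close> makes parameters cyclic, so that \<open>s = 0\<close> is not special.\<close>

definition straight_at ::
    "'a set \<times> ('a \<Rightarrow> complex) \<Rightarrow> (real \<Rightarrow> 'a) \<Rightarrow> real \<Rightarrow> complex \<Rightarrow> bool" where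
  "straight_at = (\<lambda>(U, \<phi>) a s v.
     \<exists>\<delta>>0. \<forall>u. \<bar>u\<bar> < \<delta> \<longrightarrow>
        a (frac (s + u)) \<in> U \<and> \<phi> (a (frac (s + u))) = \<phi> (a s) + of_real u * v)"

text \<open>The loops \<open>a\<close> and \<open>b\<close> cross transversally at the interior point \<open>q\<close> with sign \<open>e\<close> (\<open>1\<close> or \<open>-1\<close>):
  some chart representing the orientation \<open>\<mu>\<close> at \<open>q\<close> takes them to straight lines whose
  velocities \<open>v\<close>, \<open>w\<close> are linearly independent, and \<open>e\<close> is the sign of the determinant
  \<open>Im (cnj v * w)\<close> of \<open>(v, w)\<close>. Smooth transversal crossings are of this kind, since by the inverse
  function theorem they are straightened by a suitable chart.\<close>

definition crosses ::
    "('a \<Rightarrow> 'a local_orientation) \<Rightarrow> (real \<Rightarrow> 'a) \<Rightarrow> (real \<Rightarrow> 'a) \<Rightarrow> 'a \<Rightarrow> real \<Rightarrow> bool" where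
  "crosses \<mu> a b q e \<longleftrightarrow>
     (\<exists>(U, \<phi>)\<in>\<mu> q. Im (\<phi> q) > 0 \<and>
        (\<exists>v w. straight_at (U, \<phi>) a (param a q) v \<and> straight_at (U, \<phi>) b (param b q) w
             \<and> Im (cnj v * w) \<noteq> 0 \<and> sgn (Im (cnj v * w)) = e))"

text \<open>At a transversal crossing exactly one of the two signs occurs.\<close>

definition local_intersection ::
    "('a \<Rightarrow> 'a local_orientation) \<Rightarrow> (real \<Rightarrow> 'a) \<Rightarrow> (real \<Rightarrow> 'a) \<Rightarrow> 'a \<Rightarrow> int" where
  "local_intersection \<mu> a b q = of_bool (crosses \<mu> a b q 1) - of_bool (crosses \<mu> a b q (- 1))"

text \<open>Two loops are in general position if they meet in finitely many points, each of them a
  transversal crossing through which each of the two loops passes exactly once.\<close>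

definition general_position ::
    "('a \<Rightarrow> 'a local_orientation) \<Rightarrow> (real \<Rightarrow> 'a::topological_space) \<Rightarrow> (real \<Rightarrow> 'a) \<Rightarrow> bool" where
  "general_position \<mu> a b \<longleftrightarrow>
     finite (path_image a \<inter> path_image b) \<and>
     (\<forall>q \<in> path_image a \<inter> path_image b.
        (\<exists>!s. s \<in> {0..<1} \<and> a s = q) \<and> (\<exists>!t. t \<in> {0..<1} \<and> b t = q)
        \<and> (crosses \<mu> a b q 1 \<or> crosses \<mu> a b q (- 1)))"

definition goldman_sum ::
    "'a::topological_space set \<Rightarrow> ('a \<Rightarrow> 'a local_orientation) \<Rightarrow> (real \<Rightarrow> 'a) \<Rightarrow> (real \<Rightarrow> 'a)
      \<Rightarrow> ((real \<Rightarrow> 'a) set \<Rightarrow>\<^sub>0 'k::comm_ring_1)" where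
  "goldman_sum S \<mu> a b =
     (\<Sum>q \<in> path_image a \<inter> path_image b.
        fscale (of_int (local_intersection \<mu> a b q))
              (Poly_Mapping.single (free_class S (based_at a q +++ based_at b q)) 1))"

text \<open>The bracket of two classes is the common value of \<open>goldman_sum\<close> on all pairs of
  representatives in general position. On an oriented surface such pairs exist and the value
  does not depend on the pair (Goldman); the value \<open>0\<close> in the remaining case is a convention
  that only serves to make the definition total.\<close>

definition is_goldman_value ::
    "'a::topological_space set \<Rightarrow> ('a \<Rightarrow> 'a local_orientation) \<Rightarrow> (real \<Rightarrow> 'a) set \<Rightarrow> (real \<Rightarrow> 'a) set
      \<Rightarrow> ((real \<Rightarrow> 'a) set \<Rightarrow>\<^sub>0 'k::comm_ring_1) \<Rightarrow> bool" where
  "is_goldman_value S \<mu> \<alpha> \<beta> z \<longleftrightarrow>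
     (\<exists>a\<in>\<alpha>. \<exists>b\<in>\<beta>. general_position \<mu> a b) \<and>
     (\<forall>a\<in>\<alpha>. \<forall>b\<in>\<beta>. general_position \<mu> a b \<longrightarrow> goldman_sum S \<mu> a b = z)"

definition goldman_basis ::
    "'a::topological_space set \<Rightarrow> ('a \<Rightarrow> 'a local_orientation) \<Rightarrow> (real \<Rightarrow> 'a) set \<Rightarrow> (real \<Rightarrow> 'a) set
      \<Rightarrow> ((real \<Rightarrow> 'a) set \<Rightarrow>\<^sub>0 'k::comm_ring_1)" where
  "goldman_basis S \<mu> \<alpha> \<beta> =
     (if \<exists>z :: (real \<Rightarrow> 'a) set \<Rightarrow>\<^sub>0 'k. is_goldman_value S \<mu> \<alpha> \<beta> z
      then THE z. is_goldman_value S \<mu> \<alpha> \<beta> z else 0)"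

definition goldman_bracket ::
    "'a::topological_space set \<Rightarrow> ('a \<Rightarrow> 'a local_orientation)
      \<Rightarrow> ((real \<Rightarrow> 'a) set \<Rightarrow>\<^sub>0 'k::comm_ring_1) \<Rightarrow> ((real \<Rightarrow> 'a) set \<Rightarrow>\<^sub>0 'k)
      \<Rightarrow> ((real \<Rightarrow> 'a) set \<Rightarrow>\<^sub>0 'k)" where
  "goldman_bracket S \<mu> x y =
     extend_linear (\<lambda>\<alpha>. extend_linear (\<lambda>\<beta>. goldman_basis S \<mu> \<alpha> \<beta>) y) x"


section \<open>The map \<open>\<theta>\<close>\<close>

definition rat_embedding :: "(rat \<Rightarrow> 'k::comm_ring_1) \<Rightarrow> bool" where
  "rat_embedding \<iota> \<longleftrightarrow> inj \<iota> \<and> \<iota> 1 = 1 \<and> (\<forall>r s. \<iota> (r + s) = \<iota> r + \<iota> s \<and> \<iota> (r * s) = \<iota> r * \<iota> s)"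

definition push ::
    "'a::topological_space set \<Rightarrow> ('a \<Rightarrow> 'a)
      \<Rightarrow> ((real \<Rightarrow> 'a) set \<Rightarrow>\<^sub>0 'k::comm_ring_1) \<Rightarrow> ((real \<Rightarrow> 'a) set \<Rightarrow>\<^sub>0 'k)" where
  "push S f = extend_linear (\<lambda>\<alpha>. Poly_Mapping.single (push_class S f \<alpha>) 1)"

definition theta ::
    "(rat \<Rightarrow> 'k::comm_ring_1) \<Rightarrow> 'a::topological_space set \<Rightarrow> ('a \<Rightarrow> 'a)
      \<Rightarrow> ((real \<Rightarrow> 'a) set \<Rightarrow>\<^sub>0 'k) \<Rightarrow> ((real \<Rightarrow> 'a) set \<Rightarrow>\<^sub>0 'k)" where
  "theta \<iota> S \<tau> x = fscale (\<iota> (1 / 2)) (x - push S \<tau> x)"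

end

theory Submission
  imports Defs
begin

text \<open>The covering transformation \<open>\<tau>\<close> reverses the orientation of \<open>Ft\<close>, so it changes the sign of every
  local intersection number and \<open>[\<tau> x, \<tau> y] = - \<tau> [x, y]\<close>. As \<open>\<tau>\<close> is an involution, also
  \<open>[\<tau> x, y] = - \<tau> [x, \<tau> y]\<close>, and expanding gives \<open>[x - \<tau> x, y - \<tau> y] = (id - \<tau>) ([x, y] - [x, \<tau> y])\<close>.

  That \<open>\<tau>\<close> reverses the orientation rests on the fact that there are exactly two local orientations at each
  point: a planar embedding multiplies the winding numbers of small loops about a point by a locally
  constant sign. A point of \<open>Ft\<close> is a local orientation of \<open>F\<close>, and \<open>\<tau>\<close> must exchange the two points of each
  fibre. The orientation of \<open>Ft\<close> is, up to a sign, the tautological one; the sign is constant because \<open>Ft\<close> is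
  connected (a separation of \<open>Ft\<close> would yield a section of \<open>p\<close>, that is, an orientation of \<open>F\<close>).\<close>

section \<open>The local degree of a planar embedding\<close>

text \<open>Three difficulties shape the proof. A boundary point has no planar neighbourhood in a
  chart, so signs between charts are read at interior points only; half discs are convex, which
  keeps the sign constant right up to the boundary and gives two local orientations there as well.
  The degree of a planar embedding is an integer because it is a winding number, and a unit because
  a small circle round the image point is itself the image of a loop. Finally,
  \<open>goldman_basis\<close> is a definite description with a default branch, so the sign rule has
  to hold for the definition as a whole: \<tau> carries the predicate
  \<open>is_goldman_value\<close> for one pair of classes to the predicate for the image pair and
  back, hence the same branch is taken on both sides. Orientation reversal is expressed by charts:
  transport by \<tau>, followed by z -> - cnj z. This reflection is real linear and preserves the
  half plane, so straight crossings go to straight crossings and only the determinant changes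
  sign.\<close>

definition local_degree :: "(complex \<Rightarrow> complex) \<Rightarrow> complex \<Rightarrow> complex \<Rightarrow> bool" where
  "local_degree h z e \<longleftrightarrow>
     (\<exists>r>0. \<forall>\<gamma>. path \<gamma> \<and> pathfinish \<gamma> = pathstart \<gamma> \<and> path_image \<gamma> \<subseteq> ball z r - {z}
              \<longrightarrow> winding_number (h \<circ> \<gamma>) (h z) = e * winding_number \<gamma> z)"

lemma orientation_preserving_at_iff: "orientation_preserving_at h z \<longleftrightarrow> local_degree h z 1"
  by (simp add: orientation_preserving_at_def local_degree_def)

text \<open>A small circle has winding number 1 about its centre, so its image reads off
  \<open>e\<close>. The degree is complex only because \<open>winding_number\<close> is.\<close>

lemma local_degree_circlepath:
  assumes "local_degree h z e"
  obtains r where "r > 0"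
    and "\<And>s. \<lbrakk>0 < s; s < r\<rbrakk> \<Longrightarrow> winding_number (h \<circ> circlepath z s) (h z) = e"
proof -
  obtain r where r: "r > 0" "\<And>\<gamma>. path \<gamma> \<and> pathfinish \<gamma> = pathstart \<gamma> \<and> path_image \<gamma> \<subseteq> ball z r - {z}
              \<Longrightarrow> winding_number (h \<circ> \<gamma>) (h z) = e * winding_number \<gamma> z"
    using assms by (auto simp: local_degree_def)
  show ?thesis
  proof
    show "r > 0" by fact
    fix s :: real assume s: "0 < s" "s < r"
    then have "path_image (circlepath z s) \<subseteq> ball z r - {z}"
      by (auto simp: path_image_circlepath_nonneg dist_norm)
    with r(2)[of "circlepath z s"] s show "winding_number (h \<circ> circlepath z s) (h z) = e"
      by (simp add: winding_number_circlepath_centre)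
  qed
qed

lemma local_degree_unique:
  assumes "local_degree h z e" "local_degree h z e'"
  shows "e = e'"
proof -
  obtain r where r: "r > 0"
     "\<And>s. \<lbrakk>0 < s; s < r\<rbrakk> \<Longrightarrow> winding_number (h \<circ> circlepath z s) (h z) = e"
    using local_degree_circlepath[OF assms(1)] by blast
  obtain r' where r': "r' > 0"
     "\<And>s. \<lbrakk>0 < s; s < r'\<rbrakk> \<Longrightarrow> winding_number (h \<circ> circlepath z s) (h z) = e'"
    using local_degree_circlepath[OF assms(2)] by blast
  show ?thesis
    using r(2)[of "min r r' / 2"] r'(2)[of "min r r' / 2"] r(1) r'(1) by (simp add: min_def split: if_splits)
qed

lemma local_degree_ball:
  assumes "local_degree h z e" "open V" "z \<in> V"
  obtains r where "r > 0" "ball z r \<subseteq> V"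
    and "\<And>\<gamma>. \<lbrakk>path \<gamma>; pathfinish \<gamma> = pathstart \<gamma>; path_image \<gamma> \<subseteq> ball z r - {z}\<rbrakk>
              \<Longrightarrow> winding_number (h \<circ> \<gamma>) (h z) = e * winding_number \<gamma> z"
proof -
  obtain r where r: "r > 0" "\<And>\<gamma>. path \<gamma> \<and> pathfinish \<gamma> = pathstart \<gamma> \<and> path_image \<gamma> \<subseteq> ball z r - {z}
              \<Longrightarrow> winding_number (h \<circ> \<gamma>) (h z) = e * winding_number \<gamma> z"
    using assms by (auto simp: local_degree_def)
  obtain s where s: "s > 0" "ball z s \<subseteq> V" using assms open_contains_ball by blast
  show ?thesis
  proof (rule that[of "min r s"])
    show "0 < min r s" "ball z (min r s) \<subseteq> V" using r s by auto
    fix \<gamma> assume "path \<gamma>" "pathfinish \<gamma> = pathstart \<gamma>" "path_image \<gamma> \<subseteq> ball z (min r s) - {z}"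
    then show "winding_number (h \<circ> \<gamma>) (h z) = e * winding_number \<gamma> z" by (intro r(2)) auto
  qed
qed

text \<open>The degree depends only on the germ of the map at \<open>z\<close>; this lets
  expressions with \<open>inv_into\<close> be exchanged for simpler ones near a point.\<close>

lemma local_degree_cong:
  assumes "local_degree h z e" "open V" "z \<in> V" "\<And>w. w \<in> V \<Longrightarrow> g w = h w"
  shows "local_degree g z e"
proof -
  obtain r where r: "r > 0" "ball z r \<subseteq> V"
    and w: "\<And>\<gamma>. \<lbrakk>path \<gamma>; pathfinish \<gamma> = pathstart \<gamma>; path_image \<gamma> \<subseteq> ball z r - {z}\<rbrakk>
              \<Longrightarrow> winding_number (h \<circ> \<gamma>) (h z) = e * winding_number \<gamma> z"
    using local_degree_ball[OF assms(1-3)] by blast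
  have "winding_number (g \<circ> \<gamma>) (g z) = e * winding_number \<gamma> z"
    if \<gamma>: "path \<gamma>" "pathfinish \<gamma> = pathstart \<gamma>" "path_image \<gamma> \<subseteq> ball z r - {z}" for \<gamma>
  proof -
    have "winding_number (g \<circ> \<gamma>) (g z) = winding_number (h \<circ> \<gamma>) (h z)"
    proof -
      have "g (\<gamma> t) = h (\<gamma> t)" if "t \<in> {0..1}" for t
        using \<gamma>(3) r(2) that by (intro assms(4)) (force simp: path_image_def)
      then show ?thesis
        unfolding assms(4)[OF assms(3)] by (intro winding_number_cong) auto
    qed
    then show ?thesis using w[OF \<gamma>] by simp
  qed
  with r(1) show ?thesis unfolding local_degree_def by blast
qed

text \<open>Injectivity keeps the image of a loop around \<open>z\<close> off \<open>h z\<close>,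
  and a small ball keeps it where \<open>g\<close> has its degree; then the factors
  multiply.\<close>

lemma local_degree_compose:
  assumes h: "local_degree h z e" and g: "local_degree g (h z) e'"
    and V: "open V" "z \<in> V" "continuous_on V h" "inj_on h V"
  shows "local_degree (g \<circ> h) z (e * e')"
proof -
  obtain s where s: "s > 0"
    and ws: "\<And>\<gamma>. \<lbrakk>path \<gamma>; pathfinish \<gamma> = pathstart \<gamma>; path_image \<gamma> \<subseteq> ball (h z) s - {h z}\<rbrakk>
              \<Longrightarrow> winding_number (g \<circ> \<gamma>) (g (h z)) = e' * winding_number \<gamma> (h z)"
    using g unfolding local_degree_def by blast
  let ?W = "V \<inter> h -` ball (h z) s"
  have W: "open ?W" "z \<in> ?W"
    using V s by (auto intro: continuous_open_preimage)
  obtain r where r: "r > 0" "ball z r \<subseteq> ?W"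
    and w: "\<And>\<gamma>. \<lbrakk>path \<gamma>; pathfinish \<gamma> = pathstart \<gamma>; path_image \<gamma> \<subseteq> ball z r - {z}\<rbrakk>
              \<Longrightarrow> winding_number (h \<circ> \<gamma>) (h z) = e * winding_number \<gamma> z"
    using local_degree_ball[OF h W] by blast
  have "winding_number (g \<circ> h \<circ> \<gamma>) ((g \<circ> h) z) = e * e' * winding_number \<gamma> z"
    if \<gamma>: "path \<gamma>" "pathfinish \<gamma> = pathstart \<gamma>" "path_image \<gamma> \<subseteq> ball z r - {z}" for \<gamma>
  proof -
    have im: "path_image \<gamma> \<subseteq> ?W - {z}" using \<gamma>(3) r(2) by blast
    have "continuous_on (path_image \<gamma>) h"
      using im by (intro continuous_on_subset[OF V(3)]) auto
    then have 1: "path (h \<circ> \<gamma>)" by (rule path_continuous_image[OF \<gamma>(1)])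
    have 2: "path_image (h \<circ> \<gamma>) \<subseteq> ball (h z) s - {h z}"
      using im V(2) inj_onD[OF V(4)] unfolding path_image_compose by fastforce
    have "winding_number (g \<circ> (h \<circ> \<gamma>)) (g (h z)) = e' * winding_number (h \<circ> \<gamma>) (h z)"
      using 1 2 \<gamma>(2) by (intro ws) (auto simp: pathfinish_compose pathstart_compose)
    then show ?thesis using w[OF \<gamma>] by (simp add: o_assoc)
  qed
  with r(1) show ?thesis unfolding local_degree_def by blast
qed

section \<open>Continuous logarithms and winding numbers\<close>

lemma continuous_multiple_2pi_constant:
  fixes d :: "'a::topological_space \<Rightarrow> complex"
  assumes "connected D" "continuous_on D d" "\<And>w. w \<in> D \<Longrightarrow> exp (d w) = 1"
  shows "d constant_on D"
proof (rule continuous_discrete_range_constant[OF assms(1,2)])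
  have k: "\<exists>n::int. d w = of_int (2 * n) * pi * \<i>" if "w \<in> D" for w
    using assms(3)[OF that] exp_eq[of "d w" 0] by simp
  fix x assume x: "x \<in> D"
  \<comment> \<open>The values of \<open>d\<close> lie in 2 pi i Z, so distinct ones are at least 2
    pi apart. The criterion for constancy asks only for some positive gap, and 1 will do.\<close>
  have "1 \<le> norm (d y - d x)" if y: "y \<in> D" "d y \<noteq> d x" for y
  proof -
    obtain m n :: int where mn: "d x = of_int (2 * m) * pi * \<i>" "d y = of_int (2 * n) * pi * \<i>"
      using k x y by blast
    have "d y - d x = of_int (2 * (n - m)) * pi * \<i>" by (simp add: mn algebra_simps)
    then have *: "norm (d y - d x) = \<bar>of_int (2 * (n - m))\<bar> * pi"
      by (simp only: norm_mult norm_of_int norm_of_real) (simp add: abs_mult)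
    have "n \<noteq> m" using mn y by auto
    then have "1 \<le> \<bar>2 * (n - m)\<bar>" by simp
    then have "1 \<le> \<bar>of_int (2 * (n - m)) :: real\<bar>" by linarith
    then have "1 * 1 \<le> \<bar>of_int (2 * (n - m))\<bar> * pi"
      using pi_gt3 by (intro mult_mono) auto
    then show ?thesis using * by simp
  qed
  then show "\<exists>e>0. \<forall>y. y \<in> D \<and> d y \<noteq> d x \<longrightarrow> e \<le> norm (d y - d x)"
    by (intro exI[of _ 1]) auto
qed

text \<open>Two continuous logarithms of the same path differ by a continuous function with values
  in 2 pi i Z, that is, by a constant. Hence every logarithm, and not just one particular choice,
  computes the winding number.\<close>

lemma winding_number_exp_lift:
  assumes "path l" "\<And>t. t \<in> {0..1} \<Longrightarrow> p t = \<zeta> + exp (l t)"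
  shows "pathfinish l - pathstart l = 2 * of_real pi * \<i> * winding_number p \<zeta>"
proof -
  have "path (\<lambda>t. \<zeta> + exp (l t))"
    using assms(1) unfolding path_def by (intro continuous_intros)
  then have p: "path p"
    by (rule path_eq) (use assms(2) in auto)
  have "\<zeta> \<notin> path_image p" using assms(2) by (force simp: path_image_def)
  then obtain q where q: "path q" "pathfinish q - pathstart q = 2 * of_real pi * \<i> * winding_number p \<zeta>"
    "\<And>t. t \<in> {0..1} \<Longrightarrow> p t = \<zeta> + exp(q t)"
    using winding_number_as_continuous_log[OF p] by blast
  have "exp (l t - q t) = 1" if "t \<in> {0..1}" for t
    using assms(2)[OF that] q(3)[OF that] by (simp add: exp_diff)
  have "(\<lambda>t::real. l t - q t) constant_on {0..1}"
    using assms(1) q(1) \<open>\<And>t. t \<in> {0..1} \<Longrightarrow> exp (l t - q t) = 1\<close>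
    by (intro continuous_multiple_2pi_constant) (auto simp: path_def intro!: continuous_intros)
  then have "l 1 - q 1 = l 0 - q 0" by (auto simp: constant_on_def)
  with q(2) show ?thesis by (simp add: pathfinish_def pathstart_def algebra_simps)
qed


text \<open>A continuous logarithm \<open>L\<close> of \<open>h (z + exp w) - h z\<close> on a half plane is quasi-periodic,
  \<open>L (w + 2 \<pi> \<i>) = L w + c\<close>, and the degree is \<open>c / (2 \<pi> \<i>)\<close>.\<close>

lemma local_degree_lift:
  assumes "r > 0" and cont: "continuous_on (ball z r) h" and inj: "inj_on h (ball z r)"
  obtains e where
    "\<And>\<gamma>. \<lbrakk>path \<gamma>; pathfinish \<gamma> = pathstart \<gamma>; path_image \<gamma> \<subseteq> ball z r - {z}\<rbrakk>
              \<Longrightarrow> winding_number (h \<circ> \<gamma>) (h z) = e * winding_number \<gamma> z"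
proof -
  \<comment> \<open>The map w -> z + exp w makes the half plane \<open>D\<close> the universal cover
    of the punctured ball. Being convex, \<open>D\<close> is contractible, and the nowhere zero
    function \<open>h (z + exp w) - h z\<close> has a logarithm on it.\<close>
  define D where "D = {w. Re w < ln r}"
  have D: "w \<in> D \<longleftrightarrow> z + exp w \<in> ball z r" for w
    using assms(1) by (simp add: D_def dist_norm norm_minus_commute) (metis exp_less_cancel_iff exp_ln)
  have "convex D" unfolding D_def by (rule convex_halfspace_Re_lt)
  have "continuous_on D (\<lambda>w. h (z + exp w) - h z)"
    by (intro continuous_intros continuous_on_compose2[OF cont]) (use D in auto)
  moreover have "h (z + exp w) - h z \<noteq> 0" if "w \<in> D" for w
    using inj_onD[OF inj, of "z + exp w" z] that D assms(1) by auto
  ultimately obtain L where L: "continuous_on D L"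
    "\<And>w. w \<in> D \<Longrightarrow> h (z + exp w) - h z = exp (L w)"
    using continuous_logarithm_on_contractible[of D "\<lambda>w. h (z + exp w) - h z"]
      convex_imp_contractible[OF \<open>convex D\<close>] by blast
  let ?p = "2 * of_real pi * \<i>"
  have shift: "w + ?p * of_int k \<in> D \<longleftrightarrow> w \<in> D" for w and k :: int
    by (simp add: D_def)
  have e1: "exp (w + ?p) = exp w" for w by (simp add: exp_add)
  \<comment> \<open>As exp has period \<open>?p\<close>, both terms are logarithms of the same
    number, so their difference is a continuous multiple of 2 pi i.\<close>
  have "(\<lambda>w. L (w + ?p) - L w) constant_on D"
  proof (rule continuous_multiple_2pi_constant)
    show "connected D" using \<open>convex D\<close> convex_connected by blast
    show "continuous_on D (\<lambda>w. L (w + ?p) - L w)"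
      using shift[of _ 1] by (intro continuous_intros continuous_on_compose2[OF L(1)] L(1)) auto
    fix w assume w: "w \<in> D"
    then have "w + ?p \<in> D" using shift[of w 1] by simp
    from L(2)[OF this] L(2)[OF w] show "exp (L (w + ?p) - L w) = 1"
      by (simp add: exp_diff e1)
  qed
  then obtain c where c: "\<And>w. w \<in> D \<Longrightarrow> L (w + ?p) = L w + c"
    unfolding constant_on_def by (metis add.commute diff_eq_eq)
  have nat: "L (w + ?p * of_nat n) = L w + c * of_nat n" if "w \<in> D" for w n
  proof (induction n)
    case (Suc n)
    have "L (w + ?p * of_nat n + ?p) = L (w + ?p * of_nat n) + c"
      using shift[of w "int n"] that by (intro c) simp
    with Suc show ?case by (simp add: algebra_simps)
  qed simp
  have int: "L (w + ?p * of_int k) = L w + c * of_int k" if "w \<in> D" for w k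
  proof (cases "k \<ge> 0")
    case True
    with nat[OF that, of "nat k"] show ?thesis by simp
  next
    case False
    \<comment> \<open>For negative \<open>k\<close>, start at the shifted point and return to
      \<open>w\<close> in \<open>- k\<close> steps.\<close>
    have "L (w + ?p * of_int k + ?p * of_nat (nat (-k))) = L (w + ?p * of_int k) + c * of_nat (nat (-k))"
      using that shift by (intro nat) auto
    with False show ?thesis by (simp add: algebra_simps)
  qed
  show thesis
  proof (rule that[of "c / ?p"])
    fix \<gamma> assume \<gamma>: "path \<gamma>" "pathfinish \<gamma> = pathstart \<gamma>" "path_image \<gamma> \<subseteq> ball z r - {z}"
    obtain q where q: "path q" "pathfinish q - pathstart q = ?p * winding_number \<gamma> z"
      "\<And>t. t \<in> {0..1} \<Longrightarrow> \<gamma> t = z + exp(q t)"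
      using winding_number_as_continuous_log[of \<gamma> z] \<gamma> by blast
    have qD: "q t \<in> D" if "t \<in> {0..1}" for t
      using D q(3)[OF that] \<gamma>(3) that by (force simp: path_image_def)
    obtain k :: int where k: "winding_number \<gamma> z = of_int k"
      using integer_winding_number[of \<gamma> z] \<gamma> by (auto simp: Ints_def)
    have "path (L \<circ> q)"
      by (rule path_continuous_image[OF q(1)], rule continuous_on_subset[OF L(1)])
         (use qD in \<open>auto simp: path_image_def\<close>)
    then have "pathfinish (L \<circ> q) - pathstart (L \<circ> q) = ?p * winding_number (h \<circ> \<gamma>) (h z)"
    proof (rule winding_number_exp_lift)
      fix t :: real assume t: "t \<in> {0..1}"
      show "(h \<circ> \<gamma>) t = h z + exp ((L \<circ> q) t)"
        using L(2)[OF qD[OF t]] q(3)[OF t] by (simp add: algebra_simps)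
    qed
    \<comment> \<open>The logarithm \<open>q\<close> of \<gamma> rises by \<open>k\<close> periods,
      so the logarithm \<open>L \<circ> q\<close> of the image loop rises by
      \<open>c * k\<close>.\<close>
    moreover have "q 1 = q 0 + ?p * of_int k"
      using q(2) k by (simp add: pathfinish_def pathstart_def algebra_simps)
    then have "L (q 1) = L (q 0) + c * of_int k"
      using int[OF qD[of 0], of k] by simp
    ultimately have "c * of_int k = ?p * winding_number (h \<circ> \<gamma>) (h z)"
      by (simp add: pathfinish_def pathstart_def)
    then show "winding_number (h \<circ> \<gamma>) (h z) = c / ?p * winding_number \<gamma> z"
      by (simp add: k field_simps)
  qed
qed

text \<open>The number \<open>e\<close> is an integer, being the winding number of the image of a
  small circle. It divides 1: by invariance of domain a small circle about \<open>h z\<close> lies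
  in the image of the ball, and its preimage is a loop \<gamma> with
  \<open>e * winding_number \<gamma> z = 1\<close>.\<close>

lemma local_degree_exists:
  assumes "open V" "z \<in> V" and cont: "continuous_on V h" and inj: "inj_on h V"
  obtains e where "e \<in> {1, -1}" "local_degree h z e"
proof -
  obtain r where r: "r > 0" "ball z r \<subseteq> V" using assms open_contains_ball by blast
  have cont': "continuous_on (ball z r) h" and inj': "inj_on h (ball z r)"
    using cont inj r continuous_on_subset inj_on_subset by blast+
  obtain e where e:
    "\<And>\<gamma>. \<lbrakk>path \<gamma>; pathfinish \<gamma> = pathstart \<gamma>; path_image \<gamma> \<subseteq> ball z r - {z}\<rbrakk>
              \<Longrightarrow> winding_number (h \<circ> \<gamma>) (h z) = e * winding_number \<gamma> z"
    using local_degree_lift[OF r(1) cont' inj'] by blast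
  have "open (h ` ball z r)" by (rule invariance_of_domain[OF cont' _ inj']) simp
  moreover have "h z \<in> h ` ball z r" using r by simp
  ultimately obtain s where s: "s > 0" "cball (h z) s \<subseteq> h ` ball z r"
    using open_contains_cball by blast
  obtain g where g: "homeomorphism (ball z r) (h ` ball z r) h g"
    using invariance_of_domain_homeomorphism[OF _ cont' _ inj'] by auto
  let ?C = "circlepath (h z) s"
  have im: "path_image ?C \<subseteq> h ` ball z r - {h z}"
    using s by (auto simp: path_image_circlepath_nonneg)
  define \<gamma> where "\<gamma> = g \<circ> ?C"
  have "continuous_on (h ` ball z r) g" using g by (simp add: homeomorphism_def)
  then have "continuous_on (path_image ?C) g" by (rule continuous_on_subset) (use im in blast)
  then have 1: "path \<gamma>" unfolding \<gamma>_def by (rule path_continuous_image[OF path_circlepath])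
  have 2: "pathfinish \<gamma> = pathstart \<gamma>" by (simp add: \<gamma>_def pathfinish_compose pathstart_compose)
  have 3: "path_image \<gamma> \<subseteq> ball z r - {z}"
  proof
    fix x assume "x \<in> path_image \<gamma>"
    then obtain y where y: "y \<in> path_image ?C" "x = g y" by (auto simp: \<gamma>_def path_image_compose)
    then have "y \<in> h ` ball z r" "y \<noteq> h z" using im by auto
    then show "x \<in> ball z r - {z}" using g y by (auto simp: homeomorphism_def)
  qed
  have "winding_number (h \<circ> \<gamma>) (h z) = winding_number ?C (h z)"
  proof (rule winding_number_cong)
    fix t :: real assume "0 \<le> t" "t \<le> 1"
    then have "?C t \<in> path_image ?C" by (simp add: path_image_def)
    then have "?C t \<in> h ` ball z r" using im by blast
    then show "(h \<circ> \<gamma>) t = ?C t" using g by (auto simp: \<gamma>_def homeomorphism_def)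
  qed
  then have "1 = e * winding_number \<gamma> z"
    using e[OF 1 2 3] s by (simp add: winding_number_circlepath_centre)
  moreover obtain k :: int where k: "winding_number \<gamma> z = of_int k"
    using integer_winding_number[of \<gamma> z] 1 2 3 by (auto simp: Ints_def)
  moreover obtain m :: int where "e = of_int m"
  proof -
    let ?c = "circlepath z (r/2)"
    have c: "path_image ?c \<subseteq> ball z r - {z}"
      using r by (auto simp: path_image_circlepath_nonneg dist_norm)
    have "winding_number (h \<circ> ?c) (h z) = e"
      using e[OF _ _ c] r by (simp add: winding_number_circlepath_centre)
    moreover have "path (h \<circ> ?c)"
      by (rule path_continuous_image[OF path_circlepath], rule continuous_on_subset[OF cont']) (use c in auto)
    moreover have "h z \<notin> path_image (h \<circ> ?c)"
    proof
      assume "h z \<in> path_image (h \<circ> ?c)"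
      then obtain x where "x \<in> path_image ?c" "h z = h x" unfolding path_image_compose by blast
      with c r(1) show False using inj_onD[OF inj', of z x] by auto
    qed
    ultimately have "e \<in> \<int>"
      using integer_winding_number[of "h \<circ> ?c" "h z"] by (simp add: pathfinish_compose pathstart_compose)
    then show ?thesis using that by (auto simp: Ints_def)
  qed
  ultimately have "m * k = 1" by (metis of_int_eq_1_iff of_int_mult)
  then have "m = 1 \<or> m = -1" using zmult_eq_1_iff by blast
  then have "e \<in> {1, -1}" using \<open>e = of_int m\<close> by auto
  moreover have "local_degree h z e" using r(1) e unfolding local_degree_def by blast
  ultimately show ?thesis using that by blast
qed

text \<open>One circle about \<open>z\<close> serves all centres \<open>z'\<close> inside it: in the
  disc punctured at \<open>z'\<close> it can be shrunk to a small circle about \<open>z'\<close>,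
  and the winding number of its image is the same about \<open>h z'\<close> and
  \<open>h z\<close>.\<close>

lemma local_degree_locally_constant:
  assumes V: "open V" "z \<in> V" and cont: "continuous_on V h" and inj: "inj_on h V"
    and e: "local_degree h z e"
  obtains r where "r > 0" "ball z r \<subseteq> V" "\<And>z'. z' \<in> ball z r \<Longrightarrow> local_degree h z' e"
proof -
  obtain \<rho> where \<rho>: "\<rho> > 0" "cball z \<rho> \<subseteq> V" using V open_contains_cball by blast
  obtain \<rho>' where \<rho>': "\<rho>' > 0"
    "\<And>s. \<lbrakk>0 < s; s < \<rho>'\<rbrakk> \<Longrightarrow> winding_number (h \<circ> circlepath z s) (h z) = e"
    using local_degree_circlepath[OF e] by blast
  define s where "s = min \<rho> \<rho>' / 2"
  have s: "0 < s" "s < \<rho>'" "cball z s \<subseteq> V" using \<rho> \<rho>'(1) by (auto simp: s_def)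
  let ?C = "circlepath z s"
  have "local_degree h z' e" if z': "z' \<in> ball z s" for z'
  proof -
    have z'V: "z' \<in> V" using z' s by auto
    obtain e' where e': "local_degree h z' e'" using local_degree_exists[OF V(1) z'V cont inj] by blast
    obtain u where u: "u > 0"
      "\<And>s. \<lbrakk>0 < s; s < u\<rbrakk> \<Longrightarrow> winding_number (h \<circ> circlepath z' s) (h z') = e'"
      using local_degree_circlepath[OF e'] by blast
    \<comment> \<open>Small enough for the circle about \<open>z'\<close> to read off
      \<open>e'\<close> and to lie inside the ball of radius \<open>s\<close> about
      \<open>z\<close>.\<close>
    define \<sigma> where "\<sigma> = min u (s - dist z z') / 2"
    have \<sigma>: "0 < \<sigma>" "\<sigma> < u" "\<sigma> + dist z z' < s" using u z' by (auto simp: \<sigma>_def min_def field_simps)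
    \<comment> \<open>The linear homotopy joins points of equal angle. Relative to \<open>z'\<close>
      its points are \<open>a (z - z')\<close> plus a vector of length
      \<open>(1 - a) \<sigma> + a s\<close>; the second summand is strictly longer because
      \<open>dist z z' < s\<close>, so \<open>z'\<close> is never hit.\<close>
    have cs: "closed_segment (circlepath z' \<sigma> t) (?C t) \<subseteq> cball z s - {z'}" for t
    proof
      fix x assume "x \<in> closed_segment (circlepath z' \<sigma> t) (?C t)"
      then obtain a where a: "0 \<le> a" "a \<le> 1" and x: "x = (1 - a) *\<^sub>R circlepath z' \<sigma> t + a *\<^sub>R ?C t"
        by (auto simp: in_segment)
      let ?E = "exp (2 * of_real pi * \<i> * of_real t)"
      have nE: "norm ?E = 1" by simp
      have 1: "x - z' = of_real a * (z - z') + of_real ((1 - a) * \<sigma> + a * s) * ?E"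
        unfolding x circlepath scaleR_conv_of_real by (simp add: algebra_simps)
      have pos: "0 < (1 - a) * \<sigma> + a * s"
      proof (cases "a = 0")
        case False
        then have "0 < a * s" using a s by simp
        moreover have "0 \<le> (1 - a) * \<sigma>" using a \<sigma> by simp
        ultimately show ?thesis by linarith
      qed (use \<sigma> in simp)
      have "x \<noteq> z'"
      proof
        assume "x = z'"
        then have "of_real ((1 - a) * \<sigma> + a * s) * ?E = - (of_real a * (z - z'))"
          using 1 by (simp add: eq_neg_iff_add_eq_0 add.commute)
        then have "norm (of_real ((1 - a) * \<sigma> + a * s) * ?E) = norm (of_real a * (z - z'))"
          by (simp only: norm_minus_cancel)
        then have "(1 - a) * \<sigma> + a * s = a * dist z z'"
          using pos a unfolding norm_mult nE norm_of_real by (simp add: dist_norm)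
        moreover have "a * dist z z' \<le> a * s" using a z' by (intro mult_left_mono) auto
        ultimately have *: "(1 - a) * \<sigma> \<le> 0" "a * s = a * dist z z' - (1 - a) * \<sigma>" by auto
        with a \<sigma> have "a = 1" by (simp add: mult_le_0_iff)
        with * z' show False by simp
      qed
      moreover have "x \<in> cball z s"
      proof -
        have "circlepath z' \<sigma> t \<in> cball z s"
        proof -
          have "dist z (circlepath z' \<sigma> t) \<le> dist z z' + dist z' (circlepath z' \<sigma> t)"
            by (rule dist_triangle)
          also have "dist z' (circlepath z' \<sigma> t) = \<sigma>"
            using \<sigma> by (simp add: circlepath dist_norm norm_mult)
          finally show ?thesis using \<sigma> by simp
        qed
        moreover have "?C t \<in> cball z s" using s by (simp add: circlepath dist_norm norm_mult)
        ultimately show ?thesis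
          unfolding x using convexD[OF convex_cball, of _ z s _ "1 - a" a] a by auto
      qed
      ultimately show "x \<in> cball z s - {z'}" by simp
    qed
    have "homotopic_loops (cball z s - {z'}) (circlepath z' \<sigma>) ?C"
      by (rule homotopic_loops_linear) (use cs in auto)
    then have "homotopic_loops (- {h z'}) (h \<circ> circlepath z' \<sigma>) (h \<circ> ?C)"
    proof (rule homotopic_loops_continuous_image)
      show "continuous_on (cball z s - {z'}) h" using cont s by (meson Diff_subset continuous_on_subset)
      show "h \<in> cball z s - {z'} \<rightarrow> - {h z'}"
      proof
        fix x assume "x \<in> cball z s - {z'}"
        then have "x \<in> V" "x \<noteq> z'" using s by auto
        then show "h x \<in> - {h z'}" using inj_onD[OF inj _ _ z'V, of x] by blast
      qed
    qed
    then have "winding_number (h \<circ> circlepath z' \<sigma>) (h z') = winding_number (h \<circ> ?C) (h z')"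
      by (rule winding_number_homotopic_loops)
    \<comment> \<open>The image of the open disc is connected and, by injectivity, misses the image
      of its boundary circle.\<close>
    moreover have "winding_number (h \<circ> ?C) (h z') = winding_number (h \<circ> ?C) (h z)"
    proof (rule winding_number_eq)
      have im: "path_image ?C \<subseteq> V - ball z s" using s by (auto simp: path_image_circlepath_nonneg)
      show "path (h \<circ> ?C)"
        by (rule path_continuous_image[OF path_circlepath], rule continuous_on_subset[OF cont]) (use im in auto)
      show "pathfinish (h \<circ> ?C) = pathstart (h \<circ> ?C)" by (simp add: pathfinish_compose pathstart_compose)
      show "h z' \<in> h ` ball z s" "h z \<in> h ` ball z s" using z' s by auto
      show "connected (h ` ball z s)"
        using s by (intro connected_continuous_image continuous_on_subset[OF cont]) auto
      show "h ` ball z s \<inter> path_image (h \<circ> ?C) = {}"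
      proof -
        have "h x \<noteq> h y" if "x \<in> ball z s" "y \<in> path_image ?C" for x y
        proof -
          have "x \<in> V" "y \<in> V" "x \<noteq> y" using that im s by auto
          then show ?thesis using inj_onD[OF inj] by blast
        qed
        then show ?thesis by (auto simp: path_image_compose)
      qed
    qed
    ultimately have "e' = e" using u(2)[OF \<sigma>(1,2)] \<rho>'(2)[OF s(1,2)] by simp
    with e' show ?thesis by simp
  qed
  moreover have "ball z s \<subseteq> V" using s by auto
  ultimately show ?thesis using that s(1) by blast
qed

lemma local_degree_connected:
  assumes V: "open V" "connected V" and cont: "continuous_on V h" and inj: "inj_on h V"
  obtains e where "e \<in> {1, -1}" "\<And>z. z \<in> V \<Longrightarrow> local_degree h z e"
proof (cases "V = {}")
  case False
  then obtain z0 where z0: "z0 \<in> V" by auto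
  obtain e where e: "e \<in> {1, -1}" "local_degree h z0 e"
    using local_degree_exists[OF V(1) z0 cont inj] by blast
  have "local_degree h z e" if z: "z \<in> V" for z
  proof -
    \<comment> \<open>Having a common degree is transitive by uniqueness and holds locally by local
      constancy, so it links any two points of the connected set \<open>V\<close>.\<close>
    define R where "R = (\<lambda>a b. \<exists>d. local_degree h a d \<and> local_degree h b d)"
    have "R z0 z"
    proof (rule connected_equivalence_relation[OF V(2) z0 z])
      show "R x y \<Longrightarrow> R y x" for x y by (auto simp: R_def)
      show "R x y \<Longrightarrow> R y z \<Longrightarrow> R x z" for x y z unfolding R_def by (metis local_degree_unique)
      fix a assume a: "a \<in> V"
      obtain d where d: "local_degree h a d" using local_degree_exists[OF V(1) a cont inj] by blast
      obtain r where r: "r > 0" "ball a r \<subseteq> V" "\<And>z'. z' \<in> ball a r \<Longrightarrow> local_degree h z' d"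
        using local_degree_locally_constant[OF V(1) a cont inj d] by blast
      have "R a x" if "x \<in> ball a r" for x using d r(3)[OF that] unfolding R_def by blast
      then show "\<exists>T. openin (top_of_set V) T \<and> a \<in> T \<and> (\<forall>x\<in>T. R a x)"
        using r V(1) by (intro exI[of _ "ball a r"]) (auto simp: open_openin_trans)
    qed
    then show ?thesis using e(2) local_degree_unique unfolding R_def by blast
  qed
  with e show ?thesis using that by blast
qed (use that[of 1] in auto)

section \<open>Charts and local orientations\<close>

text \<open>Adding pi i to a logarithm changes the sign of its exponential and leaves the increment
  alone.\<close>

lemma winding_number_uminus:
  assumes "path \<gamma>" "z \<notin> path_image \<gamma>"
  shows "winding_number (uminus \<circ> \<gamma>) (- z) = winding_number \<gamma> z"
proof -
  obtain q where q: "path q" "pathfinish q - pathstart q = 2 * of_real pi * \<i> * winding_number \<gamma> z"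
    "\<And>t. t \<in> {0..1} \<Longrightarrow> \<gamma> t = z + exp (q t)"
    using winding_number_as_continuous_log[OF assms] by blast
  have "path (\<lambda>t. q t + of_real pi * \<i>)" using q(1) by (auto simp: path_def intro!: continuous_intros)
  then have "pathfinish (\<lambda>t. q t + of_real pi * \<i>) - pathstart (\<lambda>t. q t + of_real pi * \<i>)
     = 2 * of_real pi * \<i> * winding_number (uminus \<circ> \<gamma>) (- z)"
    by (rule winding_number_exp_lift) (simp add: q(3) exp_add)
  then have "2 * of_real pi * \<i> * winding_number (uminus \<circ> \<gamma>) (- z) = 2 * of_real pi * \<i> * winding_number \<gamma> z"
    using q(2) by (simp add: pathfinish_def pathstart_def)
  then show ?thesis by simp
qed

text \<open>Conjugation turns a winding number into minus its conjugate, which for an integer is its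
  negative; the remaining factor -1 is a half turn.\<close>

lemma local_degree_reflection: "local_degree (\<lambda>z. - cnj z) z (- 1)"
proof -
  have "winding_number ((\<lambda>z. - cnj z) \<circ> \<gamma>) (- cnj z) = - 1 * winding_number \<gamma> z"
    if \<gamma>: "path \<gamma>" "pathfinish \<gamma> = pathstart \<gamma>" "path_image \<gamma> \<subseteq> ball z 1 - {z}" for \<gamma>
  proof -
    have z: "z \<notin> path_image \<gamma>" using \<gamma>(3) by auto
    have c: "path (cnj \<circ> \<gamma>)" "cnj z \<notin> path_image (cnj \<circ> \<gamma>)"
      using \<gamma>(1) z by (auto simp: path_def path_image_def intro!: continuous_intros)
    have "winding_number ((\<lambda>z. - cnj z) \<circ> \<gamma>) (- cnj z) = winding_number (uminus \<circ> (cnj \<circ> \<gamma>)) (- cnj z)"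
      by (simp add: o_def)
    also have "\<dots> = winding_number (cnj \<circ> \<gamma>) (cnj z)"
      using c by (rule winding_number_uminus)
    also have "\<dots> = - cnj (winding_number \<gamma> z)"
      using \<gamma>(1) z by (rule winding_number_cnj)
    also have "cnj (winding_number \<gamma> z) = winding_number \<gamma> z"
      using integer_winding_number[OF \<gamma>(1,2) z] by (auto simp: Ints_def)
    finally show ?thesis by (simp add: o_def)
  qed
  then show ?thesis unfolding local_degree_def by (intro exI[of _ 1]) auto
qed

lemma local_degree_id: "local_degree id z 1"
  unfolding local_degree_def by (intro exI[of _ 1]) auto

section \<open>Charts, coordinate changes and interior points\<close>

lemma chartsD:
  assumes "c \<in> charts S"
  shows "openin (top_of_set S) (fst c)" "continuous_on (fst c) (snd c)" "inj_on (snd c) (fst c)"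
    "openin (top_of_set half_plane) (snd c ` fst c)"
    "continuous_on (snd c ` fst c) (inv_into (fst c) (snd c))"
    "fst c \<subseteq> S" "snd c ` fst c \<subseteq> half_plane"
proof -
  obtain \<psi> where \<psi>: "homeomorphism (fst c) (snd c ` fst c) (snd c) \<psi>"
    using assms by (auto simp: charts_def)
  show 1: "openin (top_of_set S) (fst c)" "openin (top_of_set half_plane) (snd c ` fst c)"
    using assms by (auto simp: charts_def)
  show "continuous_on (fst c) (snd c)" and inj: "inj_on (snd c) (fst c)"
    using \<psi> by (auto simp: homeomorphism_def intro: inj_on_inverseI)
  have "inv_into (fst c) (snd c) z = \<psi> z" if "z \<in> snd c ` fst c" for z
    using that \<psi> inj by (auto simp: homeomorphism_def)
  then show "continuous_on (snd c ` fst c) (inv_into (fst c) (snd c))"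
    using \<psi> by (simp add: homeomorphism_def cong: continuous_on_cong)
  show "fst c \<subseteq> S" "snd c ` fst c \<subseteq> half_plane" using 1 openin_imp_subset by blast+
qed

text \<open>The common source of all charts obtained by restriction, by lifting to a sheet along
  \<open>p\<close>, and by transport along \<tau>.\<close>

lemma charts_pullback:
  assumes c: "c \<in> charts S" and U': "openin (top_of_set S') U'" and T: "openin (top_of_set S) T" "T \<subseteq> fst c"
    and g: "homeomorphism U' T g g'" and eq: "\<And>y. y \<in> U' \<Longrightarrow> \<phi>' y = snd c (g y)"
  shows "(U', \<phi>') \<in> charts S'"
proof -
  obtain \<psi> where \<psi>: "homeomorphism (fst c) (snd c ` fst c) (snd c) \<psi>"
    using c by (auto simp: charts_def)
  have "openin (top_of_set (fst c)) T"
    using T chartsD(6)[OF c] by (meson openin_subset_trans)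
  then have "openin (top_of_set (snd c ` fst c)) (snd c ` T)"
    by (rule homeomorphism_imp_open_map[OF \<psi>])
  then have 1: "openin (top_of_set half_plane) (snd c ` T)"
    using chartsD(4)[OF c] by (rule openin_trans)
  have im: "\<phi>' ` U' = snd c ` T"
    using g eq by (auto simp: homeomorphism_def image_iff)
  have "homeomorphism T (snd c ` T) (snd c) \<psi>"
    using \<psi> T(2) by (rule homeomorphism_of_subsets) auto
  then have "homeomorphism U' (snd c ` T) (snd c \<circ> g) (g' \<circ> \<psi>)"
    by (rule homeomorphism_compose[OF g])
  then have "homeomorphism U' (snd c ` T) \<phi>' (g' \<circ> \<psi>)"
    by (rule homeomorphism_cong) (use eq in auto)
  then have "homeomorphism U' (\<phi>' ` U') \<phi>' (g' \<circ> \<psi>)" by (simp add: im)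
  then show ?thesis using U' 1 im unfolding charts_def by auto
qed

lemma charts_restrict:
  assumes "c \<in> charts S" "openin (top_of_set S) T" "T \<subseteq> fst c"
  shows "(T, snd c) \<in> charts S"
proof (rule charts_pullback[OF assms(1,2) assms(2,3)])
  show "homeomorphism T T (\<lambda>x. x) (\<lambda>x. x)" by (simp add: homeomorphism_def)
qed simp

text \<open>Chart images are open only relative to \<open>half_plane\<close>; their interior parts
  are open in the plane, where degrees and invariance of domain apply.\<close>

lemma open_image_interior:
  assumes c: "c \<in> charts S" and T: "openin (top_of_set S) T" "T \<subseteq> fst c"
  obtains G where "open G" "snd c ` T = half_plane \<inter> G"
    "snd c ` T \<inter> {z. Im z > 0} = G \<inter> {z. Im z > 0}" "open (snd c ` T \<inter> {z. Im z > 0})"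
proof -
  have "openin (top_of_set half_plane) (snd c ` T)"
    using chartsD(4)[OF charts_restrict[OF assms]] by simp
  then obtain G where G: "open G" "snd c ` T = half_plane \<inter> G"
    by (auto simp: openin_open)
  then have "snd c ` T \<inter> {z. Im z > 0} = G \<inter> {z. Im z > 0}" by (auto simp: half_plane_def)
  moreover have "open (G \<inter> {z. Im z > 0})"
    using G(1) open_halfspace_Im_gt[of 0] by auto
  ultimately show ?thesis using that G by metis
qed

text \<open>Moving up by \<open>r/2\<close> in the chart leaves the boundary line but not the chart
  image. Thus a test at interior points is never vacuous, even around a boundary point.\<close>

lemma interior_point_exists:
  assumes c: "c \<in> charts S" and T: "openin (top_of_set S) T" "T \<subseteq> fst c" and x: "x \<in> T"
  obtains y where "y \<in> T" "Im (snd c y) > 0"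
proof -
  obtain G where G: "open G" "snd c ` T = half_plane \<inter> G" using open_image_interior[OF c T] by metis
  have x': "snd c x \<in> half_plane \<inter> G" using x G(2) by blast
  then obtain r where r: "r > 0" "ball (snd c x) r \<subseteq> G" using G(1) open_contains_ball by blast
  let ?z = "snd c x + \<i> * of_real (r/2)"
  have "?z \<in> ball (snd c x) r" using r by (simp add: dist_norm norm_mult)
  then have "?z \<in> half_plane \<inter> G" using r x' by (auto simp: half_plane_def)
  then obtain y where "y \<in> T" "?z = snd c y" using G(2) by blast
  moreover have "Im ?z > 0" using x' r by (auto simp: half_plane_def)
  ultimately show ?thesis using that by metis
qed

lemma transition_map:
  assumes c: "c \<in> charts S" and d: "d \<in> charts S"
  defines "V \<equiv> snd c ` (fst c \<inter> fst d) \<inter> {z. Im z > 0}"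
    and "h \<equiv> snd d \<circ> inv_into (fst c) (snd c)"
  shows "open V" "continuous_on V h" "inj_on h V"
proof -
  have "openin (top_of_set S) (fst c \<inter> fst d)" using chartsD(1) c d by (intro openin_Int)
  then show "open V" unfolding V_def using open_image_interior[OF c] by (metis inf.cobounded1)
  have inv: "inv_into (fst c) (snd c) (snd c y) = y" if "y \<in> fst c" for y
    using chartsD(3)[OF c] that by simp
  show "continuous_on V h" unfolding h_def
  proof (rule continuous_on_compose)
    show "continuous_on V (inv_into (fst c) (snd c))"
      by (rule continuous_on_subset[OF chartsD(5)[OF c]]) (auto simp: V_def)
    show "continuous_on (inv_into (fst c) (snd c) ` V) (snd d)"
      by (rule continuous_on_subset[OF chartsD(2)[OF d]]) (auto simp: V_def inv)
  qed
  show "inj_on h V"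
  proof (rule inj_onI)
    fix z w assume "z \<in> V" "w \<in> V" and eq: "h z = h w"
    then obtain y y' where y: "y \<in> fst c \<inter> fst d" "z = snd c y" "y' \<in> fst c \<inter> fst d" "w = snd c y'"
      unfolding V_def by blast
    then have "snd d y = snd d y'" using eq inv by (simp add: h_def)
    then have "y = y'" using y inj_onD[OF chartsD(3)[OF d]] by blast
    with y show "z = w" by simp
  qed
qed

text \<open>By invariance of domain the coordinate change sends the interior part onto an open
  planar set. That set lies in the closed half plane, so it avoids the boundary line.\<close>

lemma interior_point_invariant:
  assumes c: "c \<in> charts S" and d: "d \<in> charts S" and y: "y \<in> fst c" "y \<in> fst d" "Im (snd c y) > 0"
  shows "Im (snd d y) > 0"
proof -
  let ?V = "snd c ` (fst c \<inter> fst d) \<inter> {z. Im z > 0}" and ?h = "snd d \<circ> inv_into (fst c) (snd c)"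
  have inv: "inv_into (fst c) (snd c) (snd c y) = y" if "y \<in> fst c" for y
    using chartsD(3)[OF c] that by simp
  have "open (?h ` ?V)"
    using transition_map[OF c d] by (intro invariance_of_domain)
  moreover have "?h ` ?V \<subseteq> half_plane"
  proof
    fix w assume "w \<in> ?h ` ?V"
    then obtain x where "x \<in> fst c \<inter> fst d" "w = ?h (snd c x)" by blast
    then have "w \<in> snd d ` fst d" by (simp add: inv)
    then show "w \<in> half_plane" using chartsD(7)[OF d] by blast
  qed
  ultimately have "?h ` ?V \<subseteq> interior half_plane" by (intro interior_maximal)
  also have "interior half_plane = {z. Im z > 0}"
    using interior_halfspace_ge[of \<i> 0] unfolding half_plane_def by (simp add: inner_complex_def)
  moreover have "snd d y \<in> ?h ` ?V"
  proof -
    have "snd c y \<in> ?V" using y by auto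
    moreover have "?h (snd c y) = snd d y" using inv[OF y(1)] by simp
    ultimately show ?thesis by (metis imageI)
  qed
  ultimately show ?thesis by blast
qed

section \<open>The relative sign of two charts at a point\<close>

definition relative_sign ::
    "'a::topological_space set \<Rightarrow> 'a \<Rightarrow> 'a set \<times> ('a \<Rightarrow> complex) \<Rightarrow> 'a set \<times> ('a \<Rightarrow> complex)
      \<Rightarrow> complex \<Rightarrow> bool" where
  "relative_sign S x c d e \<longleftrightarrow>
     (\<exists>W. openin (top_of_set S) W \<and> x \<in> W
       \<and> (\<forall>y \<in> W \<inter> fst c \<inter> fst d. Im (snd c y) > 0 \<longrightarrow>
             local_degree (snd d \<circ> inv_into (fst c) (snd c)) (snd c y) e))"

lemma same_orientation_at_iff: "same_orientation_at S x c d \<longleftrightarrow> relative_sign S x c d 1"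
  by (simp add: same_orientation_at_def relative_sign_def orientation_preserving_at_iff split: prod.split)

lemma charts_atD: "c \<in> charts_at S x \<Longrightarrow> c \<in> charts S" "c \<in> charts_at S x \<Longrightarrow> x \<in> fst c"
  by (auto simp: charts_at_def)

lemma charts_atI: "c \<in> charts S \<Longrightarrow> x \<in> fst c \<Longrightarrow> c \<in> charts_at S x"
  by (auto simp: charts_at_def)

lemma relative_sign_exists:
  assumes c: "c \<in> charts_at S x" and d: "d \<in> charts_at S x"
  obtains e where "e \<in> {1, -1}" "relative_sign S x c d e"
proof -
  note c' = charts_atD[OF c] and d' = charts_atD[OF d]
  let ?T = "fst c \<inter> fst d"
  let ?h = "snd d \<circ> inv_into (fst c) (snd c)"
  have T: "openin (top_of_set S) ?T" using chartsD(1) c' d' by (intro openin_Int)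
  obtain G where G: "open G" "snd c ` ?T = half_plane \<inter> G"
    "snd c ` ?T \<inter> {z. Im z > 0} = G \<inter> {z. Im z > 0}"
    using open_image_interior[OF c'(1) T] by (metis inf.cobounded1)
  have "snd c x \<in> G" using G(2) c' d' by blast
  then obtain r where r: "r > 0" "ball (snd c x) r \<subseteq> G" using G(1) open_contains_ball by blast
  \<comment> \<open>This set is a disc or the upper part of one cut by the boundary line. In either
    case it is convex, so a single degree holds on all of it, also when \<open>x\<close> is a
    boundary point.\<close>
  let ?B = "ball (snd c x) r \<inter> {z. Im z > 0}"
  have B: "?B \<subseteq> snd c ` ?T \<inter> {z. Im z > 0}" using G(3) r(2) by blast
  note h = transition_map[OF c'(1) d'(1)]
  have "convex ?B" by (intro convex_Int convex_ball convex_halfspace_Im_gt)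
  then have "connected ?B" by (rule convex_connected)
  moreover have "open ?B" using open_halfspace_Im_gt[of 0] by auto
  moreover note continuous_on_subset[OF h(2) B] inj_on_subset[OF h(3) B]
  ultimately obtain e where e: "e \<in> {1, -1}" "\<And>z. z \<in> ?B \<Longrightarrow> local_degree ?h z e"
    using local_degree_connected[of ?B ?h] by metis
  let ?W = "?T \<inter> snd c -` ball (snd c x) r"
  have "openin (top_of_set ?T) ?W"
    by (rule continuous_openin_preimage_gen) (use chartsD(2)[OF c'(1)] in \<open>auto intro: continuous_on_subset\<close>)
  then have "openin (top_of_set S) ?W" using T by (rule openin_trans)
  moreover have "x \<in> ?W" using c' d' r by auto
  moreover have "\<forall>y \<in> ?W \<inter> fst c \<inter> fst d. Im (snd c y) > 0 \<longrightarrow> local_degree ?h (snd c y) e"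
    using e(2) by auto
  ultimately show ?thesis using that e(1) unfolding relative_sign_def by blast
qed

lemma relative_sign_unique:
  assumes c: "c \<in> charts_at S x" and d: "d \<in> charts_at S x"
    and "relative_sign S x c d e" "relative_sign S x c d e'"
  shows "e = e'"
proof -
  note c' = charts_atD[OF c] and d' = charts_atD[OF d]
  obtain W W' where W: "openin (top_of_set S) W" "x \<in> W" "openin (top_of_set S) W'" "x \<in> W'"
    and 1: "\<And>y. \<lbrakk>y \<in> W; y \<in> fst c; y \<in> fst d; Im (snd c y) > 0\<rbrakk> \<Longrightarrow>
       local_degree (snd d \<circ> inv_into (fst c) (snd c)) (snd c y) e"
    and 2: "\<And>y. \<lbrakk>y \<in> W'; y \<in> fst c; y \<in> fst d; Im (snd c y) > 0\<rbrakk> \<Longrightarrow>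
       local_degree (snd d \<circ> inv_into (fst c) (snd c)) (snd c y) e'"
    using assms(3,4) unfolding relative_sign_def by blast
  have "openin (top_of_set S) (W \<inter> W' \<inter> fst c \<inter> fst d)"
    using W chartsD(1) c' d' by (intro openin_Int)
  then obtain y where "y \<in> W \<inter> W' \<inter> fst c \<inter> fst d" "Im (snd c y) > 0"
    using interior_point_exists[OF c'(1), of "W \<inter> W' \<inter> fst c \<inter> fst d" x] W c' d' by auto
  then show ?thesis using 1 2 local_degree_unique by blast
qed

lemma relative_sign_refl:
  assumes c: "c \<in> charts_at S x"
  shows "relative_sign S x c c 1"
proof -
  note c' = charts_atD[OF c]
  note o = open_image_interior[OF c'(1) chartsD(1)[OF c'(1)] subset_refl]
  have "local_degree (snd c \<circ> inv_into (fst c) (snd c)) (snd c y) 1" if "y \<in> fst c" "Im (snd c y) > 0" for y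
  proof (rule local_degree_cong[OF local_degree_id])
    show "open (snd c ` fst c \<inter> {z. Im z > 0})" using o by metis
    show "snd c y \<in> snd c ` fst c \<inter> {z. Im z > 0}" using that by auto
  qed (auto simp: f_inv_into_f)
  then show ?thesis unfolding relative_sign_def using c' chartsD(1)[OF c'(1)] by blast
qed

text \<open>The sign of \<open>d\<close> against \<open>f\<close> is tested where \<open>d\<close>
  has positive imaginary part, that of \<open>c\<close> against \<open>d\<close> where
  \<open>c\<close> has; \<open>interior_point_invariant\<close> reconciles the two tests.\<close>

lemma relative_sign_trans:
  assumes c: "c \<in> charts_at S x" and d: "d \<in> charts_at S x" and f: "f \<in> charts_at S x"
    and cd: "relative_sign S x c d e" and df: "relative_sign S x d f e'"
  shows "relative_sign S x c f (e * e')"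
proof -
  note c' = charts_atD[OF c] and d' = charts_atD[OF d] and f' = charts_atD[OF f]
  let ?h = "snd d \<circ> inv_into (fst c) (snd c)" and ?g = "snd f \<circ> inv_into (fst d) (snd d)"
  obtain W W' where W: "openin (top_of_set S) W" "x \<in> W" "openin (top_of_set S) W'" "x \<in> W'"
    and 1: "\<And>y. \<lbrakk>y \<in> W; y \<in> fst c; y \<in> fst d; Im (snd c y) > 0\<rbrakk> \<Longrightarrow> local_degree ?h (snd c y) e"
    and 2: "\<And>y. \<lbrakk>y \<in> W'; y \<in> fst d; y \<in> fst f; Im (snd d y) > 0\<rbrakk> \<Longrightarrow> local_degree ?g (snd d y) e'"
    using cd df unfolding relative_sign_def by blast
  let ?W = "W \<inter> W' \<inter> fst d"
  have "openin (top_of_set S) ?W" using W chartsD(1) d' by (intro openin_Int)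
  moreover have "x \<in> ?W" using W d' by simp
  moreover have "local_degree (snd f \<circ> inv_into (fst c) (snd c)) (snd c y) (e * e')"
    if y: "y \<in> ?W" "y \<in> fst c" "y \<in> fst f" "Im (snd c y) > 0" for y
  proof -
    have hy: "?h (snd c y) = snd d y" using chartsD(3)[OF c'(1)] y(2) by simp
    have "Im (snd d y) > 0" using interior_point_invariant[OF c'(1) d'(1)] y by simp
    then have g: "local_degree ?g (?h (snd c y)) e'" unfolding hy using 2 y by simp
    have h: "local_degree ?h (snd c y) e" using 1 y by simp
    let ?V = "snd c ` (fst c \<inter> fst d) \<inter> {z. Im z > 0}"
    have yV: "snd c y \<in> ?V" using y by auto
    have "local_degree (?g \<circ> ?h) (snd c y) (e * e')"
      using transition_map[OF c'(1) d'(1)] by (intro local_degree_compose[OF h g _ yV])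
    then show ?thesis
    proof (rule local_degree_cong[OF _ _ yV])
      show "open ?V" using transition_map[OF c'(1) d'(1)] by auto
      fix w assume "w \<in> ?V"
      then show "(snd f \<circ> inv_into (fst c) (snd c)) w = (?g \<circ> ?h) w"
        using chartsD(3)[OF c'(1)] chartsD(3)[OF d'(1)] by auto
    qed
  qed
  ultimately show ?thesis unfolding relative_sign_def by blast
qed

text \<open>Some sign \<open>e'\<close> exists in the opposite direction, and \<open>e * e'\<close>
  is the sign of \<open>c\<close> against itself. This avoids computing the degree of an inverse
  map.\<close>

lemma relative_sign_sym:
  assumes c: "c \<in> charts_at S x" and d: "d \<in> charts_at S x" and cd: "relative_sign S x c d e"
  shows "relative_sign S x d c e"
proof -
  obtain e' where e': "e' \<in> {1, -1}" "relative_sign S x d c e'" using relative_sign_exists[OF d c] by blast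
  have "e * e' = 1"
    using relative_sign_unique[OF c c relative_sign_trans[OF c d c cd e'(2)] relative_sign_refl[OF c]] .
  then have "e' = e" using e'(1) by (auto simp: minus_equation_iff)
  with e' show ?thesis by simp
qed

text \<open>The neighbourhood in the definition serves all of its points at once, so relative signs
  are locally constant.\<close>

lemma relative_sign_local:
  assumes "relative_sign S x c d e"
  obtains W where "openin (top_of_set S) W" "x \<in> W" "\<And>y. y \<in> W \<Longrightarrow> relative_sign S y c d e"
  using assms unfolding relative_sign_def by blast

text \<open>Charts that factor through \<open>f\<close> have, near the points tested, the same
  coordinate change as the charts they come from. It is applied to \<open>p\<close>, to \<tau> and
  to the identity.\<close>

lemma relative_sign_pullback:
  assumes sgn: "relative_sign S (f y) c d e"
    and c': "c' \<in> charts S'" and c: "c \<in> charts S"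
    and f: "continuous_on S' f" "f ` S' \<subseteq> S" and y: "y \<in> S'"
    and fc: "f ` fst c' \<subseteq> fst c" and fd: "f ` fst d' \<subseteq> fst d"
    and eqc: "\<And>w. w \<in> fst c' \<Longrightarrow> snd c' w = snd c (f w)"
    and eqd: "\<And>w. w \<in> fst d' \<Longrightarrow> snd d' w = snd d (f w)"
    and d': "d' \<in> charts S'"
  shows "relative_sign S' y c' d' e"
proof -
  obtain W where W: "openin (top_of_set S) W" "f y \<in> W"
    and 1: "\<And>y. \<lbrakk>y \<in> W; y \<in> fst c; y \<in> fst d; Im (snd c y) > 0\<rbrakk> \<Longrightarrow>
       local_degree (snd d \<circ> inv_into (fst c) (snd c)) (snd c y) e"
    using sgn unfolding relative_sign_def by blast
  let ?W = "S' \<inter> f -` W"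
  have "openin (top_of_set S') ?W"
    using f W(1) by (metis continuous_openin_preimage image_subset_iff_funcset)
  moreover have "y \<in> ?W" using W y by simp
  moreover have "local_degree (snd d' \<circ> inv_into (fst c') (snd c')) (snd c' w) e"
    if w: "w \<in> ?W" "w \<in> fst c'" "w \<in> fst d'" "Im (snd c' w) > 0" for w
  proof -
    let ?V = "snd c' ` (fst c' \<inter> fst d') \<inter> {z. Im z > 0}"
    have wV: "snd c' w \<in> ?V" using w by auto
    have "f w \<in> fst c" "f w \<in> fst d" using w fc fd by blast+
    then have "local_degree (snd d \<circ> inv_into (fst c) (snd c)) (snd c' w) e"
      using 1[of "f w"] w eqc[OF w(2)] by simp
    then show ?thesis
    proof (rule local_degree_cong[OF _ _ wV])
      show "open ?V" using transition_map[OF c' d'] by auto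
      fix z assume "z \<in> ?V"
      then obtain u where u: "u \<in> fst c'" "u \<in> fst d'" "z = snd c' u" by blast
      have "inv_into (fst c') (snd c') z = u" using chartsD(3)[OF c'] u by simp
      moreover have "inv_into (fst c) (snd c) z = f u"
        using chartsD(3)[OF c] u fc eqc[OF u(1)] by (auto intro!: inv_into_f_f)
      ultimately show "(snd d' \<circ> inv_into (fst c') (snd c')) z = (snd d \<circ> inv_into (fst c) (snd c)) z"
        using eqd[OF u(2)] by simp
    qed
  qed
  ultimately show ?thesis unfolding relative_sign_def by blast
qed

text \<open>The reflection in the imaginary axis reverses the orientation and, unlike conjugation,
  preserves \<open>half_plane\<close>.\<close>

definition reflect :: "'a set \<times> ('a \<Rightarrow> complex) \<Rightarrow> 'a set \<times> ('a \<Rightarrow> complex)" where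
  "reflect c = (fst c, \<lambda>y. - cnj (snd c y))"

lemma reflect_charts:
  assumes c: "c \<in> charts S"
  shows "reflect c \<in> charts S"
proof -
  let ?r = "\<lambda>z. - cnj z"
  obtain \<psi> where \<psi>: "homeomorphism (fst c) (snd c ` fst c) (snd c) \<psi>"
    using c by (auto simp: charts_def)
  have r: "homeomorphism A (?r ` A) ?r ?r" for A
    by (auto simp: homeomorphism_def image_image intro!: continuous_intros)
  have "?r ` half_plane = half_plane"
    by (auto simp: half_plane_def image_iff intro!: exI[of _ "- cnj _"])
  then have "openin (top_of_set half_plane) (?r ` snd c ` fst c)"
    using homeomorphism_imp_open_map[OF r chartsD(4)[OF c]] by simp
  moreover have "homeomorphism (fst c) (?r ` snd c ` fst c) (?r \<circ> snd c) (\<psi> \<circ> ?r)"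
    using \<psi> r by (rule homeomorphism_compose)
  ultimately show ?thesis
    using chartsD(1)[OF c] unfolding charts_def reflect_def by (auto simp: image_image o_def)
qed

lemma reflect_charts_at: "c \<in> charts_at S x \<Longrightarrow> reflect c \<in> charts_at S x"
  using reflect_charts by (fastforce simp: charts_at_def reflect_def)

lemma relative_sign_reflect:
  assumes c: "c \<in> charts_at S x"
  shows "relative_sign S x c (reflect c) (- 1)"
proof -
  note c' = charts_atD[OF c]
  note o = open_image_interior[OF c'(1) chartsD(1)[OF c'(1)] subset_refl]
  have "local_degree (snd (reflect c) \<circ> inv_into (fst c) (snd c)) (snd c y) (- 1)"
    if "y \<in> fst c" "Im (snd c y) > 0" for y
  proof (rule local_degree_cong[OF local_degree_reflection])
    show "open (snd c ` fst c \<inter> {z. Im z > 0})" using o by metis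
    show "snd c y \<in> snd c ` fst c \<inter> {z. Im z > 0}" using that by auto
  qed (auto simp: f_inv_into_f reflect_def)
  then show ?thesis unfolding relative_sign_def using c' chartsD(1)[OF c'(1)] by blast
qed

section \<open>Local orientations as classes of charts\<close>

lemma equiv_same_orientation:
  "equiv (charts_at S x) {(c, d). c \<in> charts_at S x \<and> d \<in> charts_at S x \<and> same_orientation_at S x c d}"
  unfolding same_orientation_at_iff
proof (rule equivI)
  show "refl_on (charts_at S x) {(c, d). c \<in> charts_at S x \<and> d \<in> charts_at S x \<and> relative_sign S x c d 1}"
    by (auto simp: refl_on_def relative_sign_refl)
  show "sym {(c, d). c \<in> charts_at S x \<and> d \<in> charts_at S x \<and> relative_sign S x c d 1}"
    by (auto simp: sym_def relative_sign_sym)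
  have "relative_sign S x c f 1" if "c \<in> charts_at S x" "d \<in> charts_at S x" "f \<in> charts_at S x"
      "relative_sign S x c d 1" "relative_sign S x d f 1" for c d f
    using relative_sign_trans[OF that] by simp
  then show "trans {(c, d). c \<in> charts_at S x \<and> d \<in> charts_at S x \<and> relative_sign S x c d 1}"
    unfolding trans_def by blast
qed auto

lemma local_orientationE:
  assumes "\<omega> \<in> local_orientations S x"
  obtains c where "c \<in> charts_at S x" "c \<in> \<omega>"
proof -
  obtain c where "c \<in> charts_at S x" "\<omega> = {(c, d). c \<in> charts_at S x \<and> d \<in> charts_at S x \<and> same_orientation_at S x c d} `` {c}"
    using assms unfolding local_orientations_def by (rule quotientE)
  then show ?thesis using that equiv_class_self[OF equiv_same_orientation] by blast
qed

text \<open>Any member may serve as the representative, so membership in an orientation becomes a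
  statement about signs.\<close>

lemma local_orientation_mem_iff:
  assumes "\<omega> \<in> local_orientations S x" "c \<in> \<omega>"
  shows "d \<in> \<omega> \<longleftrightarrow> d \<in> charts_at S x \<and> relative_sign S x c d 1"
proof -
  obtain b where b: "b \<in> charts_at S x"
    "\<omega> = {(c, d). c \<in> charts_at S x \<and> d \<in> charts_at S x \<and> same_orientation_at S x c d} `` {b}"
    using assms(1) unfolding local_orientations_def by (rule quotientE)
  have "\<omega> = {(c, d). c \<in> charts_at S x \<and> d \<in> charts_at S x \<and> same_orientation_at S x c d} `` {c}"
    using assms(2) unfolding b(2) by (intro equiv_class_eq[OF equiv_same_orientation]) simp
  moreover have "c \<in> charts_at S x" using assms(2) unfolding b(2) by simp
  ultimately show ?thesis by (simp add: same_orientation_at_iff)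
qed

lemma local_orientation_charts_at: "\<omega> \<in> local_orientations S x \<Longrightarrow> c \<in> \<omega> \<Longrightarrow> c \<in> charts_at S x"
  using local_orientation_mem_iff by blast

lemma local_orientation_eqI:
  assumes "\<omega> \<in> local_orientations S x" "\<omega>' \<in> local_orientations S x" "c \<in> \<omega>" "c \<in> \<omega>'"
  shows "\<omega> = \<omega>'"
  using local_orientation_mem_iff assms by blast

lemma local_orientation_exists:
  assumes "c \<in> charts_at S x"
  obtains \<omega> where "\<omega> \<in> local_orientations S x" "c \<in> \<omega>"
  using that quotientI[OF assms] equiv_class_self[OF equiv_same_orientation assms]
  unfolding local_orientations_def by blast

lemma reflect_not_mem:
  assumes "\<omega> \<in> local_orientations S x" "c \<in> \<omega>"
  shows "reflect c \<notin> \<omega>"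
proof
  assume "reflect c \<in> \<omega>"
  then have "relative_sign S x c (reflect c) 1" using local_orientation_mem_iff[OF assms] by blast
  moreover note local_orientation_charts_at[OF assms]
  ultimately have "(1::complex) = - 1"
    using relative_sign_unique relative_sign_reflect reflect_charts_at by blast
  then show False by simp
qed

text \<open>This is the form in which the existence of exactly two local orientations is used: a
  chart has sign 1 or -1 against a member of \<omega>, and reflecting it exchanges the two
  cases.\<close>

lemma reflect_mem_iff:
  assumes "\<omega> \<in> local_orientations S x" "c \<in> charts_at S x"
  shows "reflect c \<in> \<omega> \<longleftrightarrow> c \<notin> \<omega>"
proof
  assume *: "c \<notin> \<omega>"
  obtain d where d: "d \<in> charts_at S x" "d \<in> \<omega>" using local_orientationE[OF assms(1)] by blast
  obtain e where e: "e \<in> {1, -1}" "relative_sign S x d c e" using relative_sign_exists[OF d(1) assms(2)] by blast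
  then have "e = -1" using local_orientation_mem_iff[OF assms(1) d(2)] * assms(2) by blast
  then have "relative_sign S x d (reflect c) 1"
    using relative_sign_trans[OF d(1) assms(2) reflect_charts_at[OF assms(2)] e(2) relative_sign_reflect[OF assms(2)]]
    by simp
  then show "reflect c \<in> \<omega>" using local_orientation_mem_iff[OF assms(1) d(2)] reflect_charts_at[OF assms(2)] by blast
qed (use reflect_not_mem[OF assms(1)] in blast)

section \<open>The orientation cover\<close>

lemma covering_map_open:
  assumes "covering_space C p S" and T: "openin (top_of_set C) T"
  shows "openin (top_of_set S) (p ` T)"
proof (subst openin_subopen, clarify)
  fix y assume y: "y \<in> T"
  have "y \<in> C" using T y openin_imp_subset by blast
  then have "p y \<in> S" using assms(1) by (auto simp: covering_space_def)
  then obtain X v where X: "p y \<in> X" "openin (top_of_set S) X" and v: "\<Union>v = C \<inter> p -` X"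
    "\<And>u. u \<in> v \<Longrightarrow> openin (top_of_set C) u" "\<And>u. u \<in> v \<Longrightarrow> \<exists>q. homeomorphism u X p q"
    using assms(1) unfolding covering_space_def by meson
  obtain u where u: "u \<in> v" "y \<in> u" using v(1) X(1) \<open>y \<in> C\<close> by blast
  obtain q where q: "homeomorphism u X p q" using v(3)[OF u(1)] by blast
  have "u \<subseteq> C" using v(1) u(1) by blast
  moreover obtain G where "open G" "T = C \<inter> G" using T by (auto simp: openin_open)
  ultimately have "openin (top_of_set u) (u \<inter> T)" by (auto simp: openin_open)
  then have "openin (top_of_set X) (p ` (u \<inter> T))" by (rule homeomorphism_imp_open_map[OF q])
  then have "openin (top_of_set S) (p ` (u \<inter> T))" using X(2) by (rule openin_trans)
  then show "\<exists>T'. openin (top_of_set S) T' \<and> p y \<in> T' \<and> T' \<subseteq> p ` T"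
    using u y by (intro exI[of _ "p ` (u \<inter> T)"]) auto
qed

lemma reflect_reflect [simp]: "reflect (reflect c) = c"
  by (simp add: reflect_def prod_eq_iff)

lemma fst_reflect [simp]: "fst (reflect c) = fst c"
  by (simp add: reflect_def)

section \<open>Sheets over charts and the connectedness of the orientation cover\<close>

locale oriented_sheets =
  fixes Ft :: "'b::topological_space set" and p :: "'b \<Rightarrow> 'a::topological_space" and F :: "'a set"
    and ori :: "'b \<Rightarrow> 'a local_orientation"
  assumes covering: "covering_space Ft p F"
    and bij: "bij_betw (\<lambda>y. (p y, ori y)) Ft (SIGMA x:F. local_orientations F x)"
    and sheet_open: "\<And>c. c \<in> charts F \<Longrightarrow> openin (top_of_set Ft) {y \<in> Ft. c \<in> ori y}"
    and charts_cover: "\<And>x. x \<in> F \<Longrightarrow> \<exists>c\<in>charts F. x \<in> fst c"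
begin

definition sheet :: "'a set \<times> ('a \<Rightarrow> complex) \<Rightarrow> 'b set" where
  "sheet c = {y \<in> Ft. c \<in> ori y}"

text \<open>For \<open>c\<close> in \<open>ori y\<close> these lifts define the tautological
  orientation of \<open>Ft\<close> at \<open>y\<close>.\<close>

definition lift_chart :: "'a set \<times> ('a \<Rightarrow> complex) \<Rightarrow> 'b set \<times> ('b \<Rightarrow> complex)" where
  "lift_chart c = (sheet c, \<lambda>y. snd c (p y))"

lemma proj_in: "y \<in> Ft \<Longrightarrow> p y \<in> F"
  and ori_in: "y \<in> Ft \<Longrightarrow> ori y \<in> local_orientations F (p y)"
  using bij by (auto simp: bij_betw_def)

lemma ori_charts_at: "y \<in> Ft \<Longrightarrow> c \<in> ori y \<Longrightarrow> c \<in> charts_at F (p y)"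
  using local_orientation_charts_at ori_in by blast

lemma sheetI: "y \<in> Ft \<Longrightarrow> c \<in> ori y \<Longrightarrow> y \<in> sheet c"
  and sheetD: "y \<in> sheet c \<Longrightarrow> y \<in> Ft" "y \<in> sheet c \<Longrightarrow> c \<in> ori y"
  by (auto simp: sheet_def)

lemma ori_chart_exists:
  assumes "y \<in> Ft"
  obtains c where "c \<in> ori y" "c \<in> charts_at F (p y)" "y \<in> sheet c"
proof -
  obtain c where "c \<in> charts_at F (p y)" "c \<in> ori y"
    using local_orientationE[OF ori_in[OF assms]] by blast
  with that assms show ?thesis by (blast intro: sheetI)
qed

lemma fibre_exists:
  assumes "x \<in> F" "\<omega> \<in> local_orientations F x"
  obtains y where "y \<in> Ft" "p y = x" "ori y = \<omega>"
proof -
  have "(x, \<omega>) \<in> (\<lambda>y. (p y, ori y)) ` Ft" using bij assms by (simp add: bij_betw_def)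
  then show ?thesis using that by blast
qed

text \<open>A chart represents only one orientation at each point, so on its sheet the projection
  determines the orientation, and both together determine the point.\<close>

lemma inj_on_sheet: "inj_on p (sheet c)"
proof (rule inj_onI)
  fix y y' assume y: "y \<in> sheet c" "y' \<in> sheet c" and eq: "p y = p y'"
  have "ori y = ori y'"
    using local_orientation_eqI[of "ori y" F "p y" "ori y'" c] ori_in[OF sheetD(1)[OF y(1)]]
      ori_in[OF sheetD(1)[OF y(2)]] sheetD(2)[OF y(1)] sheetD(2)[OF y(2)] eq by simp
  moreover have "inj_on (\<lambda>y. (p y, ori y)) Ft" using bij by (simp add: bij_betw_def)
  ultimately show "y = y'" using eq inj_onD[of "\<lambda>y. (p y, ori y)" Ft y y'] sheetD(1)[OF y(1)] sheetD(1)[OF y(2)] by simp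
qed

lemma sheet_image:
  assumes c: "c \<in> charts F"
  shows "p ` sheet c = fst c"
proof
  show "p ` sheet c \<subseteq> fst c"
    using ori_charts_at charts_atD(2) sheetD by blast
  show "fst c \<subseteq> p ` sheet c"
  proof
    fix x assume x: "x \<in> fst c"
    then obtain \<omega> where \<omega>: "\<omega> \<in> local_orientations F x" "c \<in> \<omega>"
      using local_orientation_exists[OF charts_atI[OF c]] by blast
    have "x \<in> F" using chartsD(6)[OF c] x by blast
    then obtain y where "y \<in> Ft" "p y = x" "ori y = \<omega>" using fibre_exists \<omega>(1) by blast
    then show "x \<in> p ` sheet c" using \<omega>(2) sheetI by blast
  qed
qed

lemma sheet_cases:
  assumes y: "y \<in> Ft" and c: "c \<in> charts F" and py: "p y \<in> fst c"
  shows "y \<in> sheet (reflect c) \<longleftrightarrow> y \<notin> sheet c"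
  using reflect_mem_iff[OF ori_in[OF y] charts_atI[OF c py]] y by (auto simp: sheet_def)

lemma openin_sheet: "c \<in> charts F \<Longrightarrow> openin (top_of_set Ft) (sheet c)"
  using sheet_open by (simp add: sheet_def)

lemma continuous_proj: "continuous_on Ft p"
  using covering by (simp add: covering_space_def)

text \<open>On a sheet the projection is injective and, as a covering map, open; hence it is a
  homeomorphism onto the chart domain.\<close>

lemma lift_chart_charts:
  assumes c: "c \<in> charts F"
  shows "lift_chart c \<in> charts Ft"
proof -
  have sub: "sheet c \<subseteq> Ft" using sheetD by blast
  obtain q where "homeomorphism (sheet c) (fst c) p q"
  proof (rule homeomorphism_injective_open_map)
    show "continuous_on (sheet c) p" using continuous_proj sub by (rule continuous_on_subset)
    show "p ` sheet c = fst c" by (rule sheet_image[OF c])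
    show "inj_on p (sheet c)" by (rule inj_on_sheet)
    fix U assume U: "openin (top_of_set (sheet c)) U"
    then have "openin (top_of_set Ft) U" using openin_sheet[OF c] by (rule openin_trans)
    then have "openin (top_of_set F) (p ` U)" by (rule covering_map_open[OF covering])
    moreover have "p ` U \<subseteq> fst c" using sheet_image[OF c] openin_imp_subset[OF U] by blast
    ultimately show "openin (top_of_set (fst c)) (p ` U)"
      using chartsD(6)[OF c] by (rule openin_subset_trans)
  qed
  then show ?thesis unfolding lift_chart_def
    by (rule charts_pullback[OF c openin_sheet[OF c] chartsD(1)[OF c] subset_refl]) simp
qed

lemma lift_chart_charts_at: "y \<in> Ft \<Longrightarrow> c \<in> ori y \<Longrightarrow> lift_chart c \<in> charts_at Ft y"
  using lift_chart_charts[OF charts_atD(1)[OF ori_charts_at]] sheetI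
  by (intro charts_atI) (auto simp: lift_chart_def)

text \<open>Makes the tautological orientation independent of the chart chosen in
  \<open>ori y\<close>.\<close>

lemma relative_sign_lift_chart:
  assumes y: "y \<in> Ft" and c: "c \<in> ori y" and d: "d \<in> ori y"
  shows "relative_sign Ft y (lift_chart c) (lift_chart d) 1"
proof (rule relative_sign_pullback)
  show "relative_sign F (p y) c d 1"
    using local_orientation_mem_iff[OF ori_in[OF y] c] d by blast
  show C: "c \<in> charts F" and "lift_chart c \<in> charts Ft" "lift_chart d \<in> charts Ft"
    using ori_charts_at[OF y c] ori_charts_at[OF y d] charts_atD(1) lift_chart_charts by blast+
  have D: "d \<in> charts F" using ori_charts_at[OF y d] charts_atD(1) by blast
  show "continuous_on Ft p" by (rule continuous_proj)
  show "p ` Ft \<subseteq> F" using proj_in by blast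
  show "p ` fst (lift_chart c) \<subseteq> fst c" using sheet_image[OF C] by (simp add: lift_chart_def)
  show "p ` fst (lift_chart d) \<subseteq> fst d" using sheet_image[OF D] by (simp add: lift_chart_def)
qed (auto simp: lift_chart_def y)

lemma fibre_reflect:
  assumes "y \<in> Ft" "y' \<in> Ft" "p y = p y'" "y \<noteq> y'" "c \<in> ori y"
  shows "reflect c \<in> ori y'"
proof -
  have "y' \<notin> sheet c" using inj_onD[OF inj_on_sheet, of y y' c] sheetI assms by blast
  then have "c \<notin> ori y'" using sheetI assms(2) by blast
  then show ?thesis
    using reflect_mem_iff[OF ori_in[OF assms(2)]] ori_charts_at[OF assms(1,5)] assms(3) by simp
qed

text \<open>For a separation into \<open>A\<close> and \<open>B\<close>, the points of
  \<open>F\<close> whose fibre lies in \<open>A\<close>, lies in \<open>B\<close>, or meets both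
  form three disjoint open sets. Connectedness of \<open>F\<close> leaves only the third, so
  \<open>A\<close> contains exactly one point of each fibre.\<close>

lemma connected_cover:
  assumes conn: "connected F" and nonor: "\<not> orientable F"
  shows "connected Ft"
proof (rule ccontr)
  assume "\<not> connected Ft"
  then obtain A B where AB: "openin (top_of_set Ft) A" "openin (top_of_set Ft) B" "Ft \<subseteq> A \<union> B"
    "A \<inter> B = {}" "A \<noteq> {}" "B \<noteq> {}"
    unfolding connected_openin by blast
  have sub: "A \<subseteq> Ft" "B \<subseteq> Ft" using AB openin_imp_subset by blast+
  define D where "D X = {x \<in> F. \<forall>y\<in>Ft. p y = x \<longrightarrow> y \<in> X}" for X
  have D_open: "openin (top_of_set F) (D X)" if X: "openin (top_of_set Ft) X" for X
  proof (subst openin_subopen, clarify)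
    fix x assume x: "x \<in> D X"
    then have "x \<in> F" by (simp add: D_def)
    then obtain c where c: "c \<in> charts F" "x \<in> fst c" using charts_cover by blast
    note rc = reflect_charts[OF c(1)]
    \<comment> \<open>A fibre over the domain of \<open>c\<close> has one point on each of the two
      sheets; \<open>?T\<close> asks both to lie in \<open>X\<close>.\<close>
    let ?T = "p ` (sheet c \<inter> X) \<inter> p ` (sheet (reflect c) \<inter> X)"
    have "openin (top_of_set F) ?T"
      by (intro openin_Int covering_map_open[OF covering] openin_sheet c(1) rc X)
    moreover have "x \<in> ?T"
    proof -
      have "x \<in> p ` sheet c" "x \<in> p ` sheet (reflect c)"
        by (simp_all add: sheet_image c rc)
      then obtain y1 y2 where y: "y1 \<in> sheet c" "p y1 = x" "y2 \<in> sheet (reflect c)" "p y2 = x"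
        by (elim imageE) simp
      have D: "\<And>y. \<lbrakk>y \<in> Ft; p y = x\<rbrakk> \<Longrightarrow> y \<in> X" using x by (simp add: D_def)
      have "y1 \<in> X" "y2 \<in> X" using D[OF sheetD(1)[OF y(1)] y(2)] D[OF sheetD(1)[OF y(3)] y(4)] .
      then show ?thesis using y by (metis IntI imageI)
    qed
    moreover have "?T \<subseteq> D X"
    proof
      fix x' assume "x' \<in> ?T"
      then obtain y1 y2 where y: "y1 \<in> sheet c" "y1 \<in> X" "y2 \<in> sheet (reflect c)" "y2 \<in> X"
        "x' = p y1" "x' = p y2" by blast
      have "y \<in> X" if "y \<in> Ft" "p y = x'" for y
      proof (cases "y \<in> sheet c")
        case True
        then have "y = y1" using inj_onD[OF inj_on_sheet] y(1,5) that by blast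
        then show ?thesis using y by simp
      next
        case False
        have "p y \<in> fst c" using y(1,5) that sheet_image[OF c(1)] by blast
        then have "y \<in> sheet (reflect c)" using False sheet_cases[OF that(1) c(1)] by blast
        then have "y = y2" using inj_onD[OF inj_on_sheet] y(3,6) that by blast
        then show ?thesis using y by simp
      qed
      moreover have "x' \<in> F" using y sheetD(1) proj_in by blast
      ultimately show "x' \<in> D X" by (simp add: D_def)
    qed
    ultimately show "\<exists>T. openin (top_of_set F) T \<and> x \<in> T \<and> T \<subseteq> D X" by blast
  qed
  have fibre: "\<exists>y\<in>Ft. p y = x" if "x \<in> F" for x
    using covering that unfolding covering_space_def by blast
  let ?C = "p ` A \<inter> p ` B"
  have C_open: "openin (top_of_set F) ?C"
    using covering_map_open[OF covering] AB by (intro openin_Int) auto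
  \<comment> \<open>If one fibre lay entirely in \<open>X\<close>, all would, and the other piece
    \<open>Y\<close> would be empty.\<close>
  have *: "D X = {}" if XY: "X = A \<and> Y = B \<or> X = B \<and> Y = A" for X Y
  proof (rule ccontr)
    assume ne: "D X \<noteq> {}"
    have X: "openin (top_of_set Ft) X" and Y: "openin (top_of_set Ft) Y" using XY AB by auto
    have 1: "F \<subseteq> D X \<union> (D Y \<union> ?C)"
    proof
      fix x assume x: "x \<in> F"
      show "x \<in> D X \<union> (D Y \<union> ?C)"
      proof (rule ccontr)
        assume n: "x \<notin> D X \<union> (D Y \<union> ?C)"
        then have "x \<notin> D X" "x \<notin> D Y" by simp_all
        with x obtain y where y: "y \<in> Ft" "p y = x" "y \<notin> X" by (auto simp: D_def)
        obtain y' where y': "y' \<in> Ft" "p y' = x" "y' \<notin> Y" using x \<open>x \<notin> D Y\<close> by (auto simp: D_def)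
        have "y \<in> Y" "y' \<in> X" using XY AB(3) y y' by blast+
        then have "x \<in> p ` Y" "x \<in> p ` X" using y(2) y'(2) by (metis imageI)+
        then have "x \<in> ?C" using XY by blast
        with n show False by blast
      qed
    qed
    have 2: "D X \<inter> (D Y \<union> ?C) = {}"
    proof -
      have False if x: "x \<in> D X" "x \<in> D Y \<union> ?C" for x
      proof -
        have "x \<in> F" using x(1) by (simp add: D_def)
        have "\<exists>y\<in>Y. y \<in> Ft \<and> p y = x"
        proof (cases "x \<in> D Y")
          case True
          then show ?thesis using fibre[OF \<open>x \<in> F\<close>] by (auto simp: D_def)
        next
          case False
          then have "x \<in> p ` A" "x \<in> p ` B" using x by auto
          then show ?thesis using XY sub by auto
        qed
        then show False using x(1) XY AB(4) by (auto simp: D_def)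
      qed
      then show ?thesis by blast
    qed
    have "openin (top_of_set F) (D Y \<union> ?C)" using D_open[OF Y] C_open by (rule openin_Un)
    then have "D Y \<union> ?C = {}"
      using conn D_open[OF X] 1 2 ne unfolding connected_openin by blast
    then have "F \<subseteq> D X" using 1 by blast
    then have "Ft \<subseteq> X" using proj_in by (auto simp: D_def)
    then show False using XY AB sub by blast
  qed
  have FC: "x \<in> p ` A" "x \<in> p ` B" if "x \<in> F" for x
  proof -
    have nD: "D A = {}" "D B = {}" using *[of A B] *[of B A] by simp_all
    from nD(1) that obtain y where y: "y \<in> Ft" "p y = x" "y \<notin> A" by (auto simp: D_def)
    from nD(2) that obtain y' where y': "y' \<in> Ft" "p y' = x" "y' \<notin> B" by (auto simp: D_def)
    have "y \<in> B" "y' \<in> A" using y y' AB(3) by blast+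
    then show "x \<in> p ` A" "x \<in> p ` B" using y(2) y'(2) by (metis imageI)+
  qed
  \<comment> \<open>Both points differ from the point \<open>y2\<close> of the same fibre in
    \<open>B\<close>, so both carry the orientation opposite to \<open>ori y2\<close>.\<close>
  have uniq: "y = y1" if y: "y \<in> A" "y1 \<in> A" "p y = p y1" for y y1
  proof -
    have "p y \<in> F" using y sub proj_in by blast
    then have "p y \<in> p ` B" by (rule FC(2))
    then obtain y2 where y2: "y2 \<in> B" "p y2 = p y" by (elim imageE) simp
    have ft: "y \<in> Ft" "y1 \<in> Ft" "y2 \<in> Ft" using y y2 sub by auto
    have ne: "y2 \<noteq> y" "y2 \<noteq> y1" using y y2 AB(4) by auto
    obtain c where c: "c \<in> ori y2" using ori_chart_exists[OF ft(3)] by blast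
    have "reflect c \<in> ori y" "reflect c \<in> ori y1"
      using fibre_reflect[OF ft(3,1) _ ne(1) c] fibre_reflect[OF ft(3,2) _ ne(2) c] y y2 by auto
    then show ?thesis using inj_onD[OF inj_on_sheet y(3)] sheetI[OF ft(1)] sheetI[OF ft(2)] by metis
  qed
  define s where "s x = (SOME y. y \<in> A \<and> p y = x)" for x
  have s: "s x \<in> A" "p (s x) = x" if "x \<in> F" for x
  proof -
    have "\<exists>y. y \<in> A \<and> p y = x" using FC(1)[OF that] by blast
    then have "s x \<in> A \<and> p (s x) = x" unfolding s_def by (rule someI_ex)
    then show "s x \<in> A" "p (s x) = x" by auto
  qed
  have "is_orientation F (\<lambda>x. ori (s x))" unfolding is_orientation_def
  proof (intro ballI conjI)
    fix x assume x: "x \<in> F"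
    note sx = s[OF x]
    have sF: "s x \<in> Ft" using sx sub by blast
    show lo: "ori (s x) \<in> local_orientations F x" using ori_in[OF sF] sx by simp
    obtain c where c: "c \<in> ori (s x)" "c \<in> charts_at F x" "s x \<in> sheet c"
      using ori_chart_exists[OF sF] sx(2) by auto
    note c' = charts_atD(1)[OF c(2)]
    \<comment> \<open>Over this smaller domain the section \<open>s\<close> stays on the sheet of
      \<open>c\<close>, so the restricted chart represents \<open>ori (s y)\<close> at every point
      \<open>y\<close> of it.\<close>
    let ?U = "p ` (sheet c \<inter> A)"
    have U: "openin (top_of_set F) ?U"
      using covering_map_open[OF covering] openin_sheet[OF c'] AB(1) by blast
    have Uc: "?U \<subseteq> fst c" using sheet_image[OF c'] by blast
    have ch: "(?U, snd c) \<in> charts F" using charts_restrict[OF c' U Uc] .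
    have mem: "(?U, snd c) \<in> ori (s y)" if y: "y \<in> ?U" for y
    proof -
      obtain y' where y': "y' \<in> sheet c" "y' \<in> A" "y = p y'" using y by blast
      have yF: "y \<in> F" using y' sheetD(1) proj_in by blast
      have "s y = y'" using uniq s[OF yF] y' by blast
      then have cs: "c \<in> ori (s y)" "s y \<in> Ft" using y' sheetD by blast+
      have cy: "c \<in> charts_at F y" using ori_charts_at[OF cs(2,1)] s[OF yF] by simp
      have "relative_sign F y c (?U, snd c) 1"
        by (rule relative_sign_pullback[where f = "\<lambda>x. x", OF relative_sign_refl[OF cy] c' c' _ _ yF])
           (use Uc ch in auto)
      moreover have lo: "ori (s y) \<in> local_orientations F y" using ori_in[OF cs(2)] s[OF yF] by simp
      moreover have "(?U, snd c) \<in> charts_at F y" using charts_atI[OF ch] y by simp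
      ultimately show ?thesis using local_orientation_mem_iff[OF lo cs(1)] by blast
    qed
    have "x \<in> ?U" using c(3) sx by force
    then show "\<exists>(U, \<phi>)\<in>ori (s x). \<forall>y\<in>U. (U, \<phi>) \<in> ori (s y)"
      using mem by (intro bexI[of _ "(?U, snd c)"]) auto
  qed
  with nonor show False unfolding orientable_def by blast
qed

end

section \<open>The covering transformation and the orientation of the cover\<close>

locale oriented_sheets_involution = oriented_sheets Ft p F ori
  for Ft :: "'b::topological_space set" and p :: "'b \<Rightarrow> 'a::topological_space" and F ori +
  fixes \<tau> :: "'b \<Rightarrow> 'b" and \<mu> :: "'b \<Rightarrow> 'b local_orientation"
  assumes connected_Ft: "connected Ft" and deck: "covering_transformation Ft p \<tau>"
    and nontrivial: "\<exists>y\<in>Ft. \<tau> y \<noteq> y" and orientation: "is_orientation Ft \<mu>"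
begin

lemma deck_continuous: "continuous_on Ft \<tau>"
  and deck_in: "y \<in> Ft \<Longrightarrow> \<tau> y \<in> Ft"
  and deck_proj: "y \<in> Ft \<Longrightarrow> p (\<tau> y) = p y"
  using deck by (auto simp: covering_transformation_def homeomorphism_def)

lemma openin_deck_vimage: "openin (top_of_set Ft) T \<Longrightarrow> openin (top_of_set Ft) (Ft \<inter> \<tau> -` T)"
  using deck_continuous deck_in by (intro continuous_openin_preimage) auto

text \<open>Being fixed by \<tau> is a locally constant property: near a fixed point \<tau> stays on
  the sheet, near a moved point it goes to the opposite sheet. Connectedness then spreads the one
  moved point to all of \<open>Ft\<close>.\<close>

lemma deck_moves:
  assumes "y \<in> Ft"
  shows "\<tau> y \<noteq> y"
proof -
  obtain y0 where y0: "y0 \<in> Ft" "\<tau> y0 \<noteq> y0" using nontrivial by blast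
  have "(\<tau> y0 = y0) = (\<tau> y = y)"
  proof (rule connected_equivalence_relation[OF connected_Ft y0(1) assms])
    fix a assume a: "a \<in> Ft"
    obtain c where c: "c \<in> ori a" "c \<in> charts_at F (p a)" "a \<in> sheet c" using ori_chart_exists[OF a] by blast
    note c' = charts_atD(1)[OF c(2)]
    show "\<exists>T. openin (top_of_set Ft) T \<and> a \<in> T \<and> (\<forall>x\<in>T. (\<tau> a = a) = (\<tau> x = x))"
    proof (cases "\<tau> a = a")
      case True
      let ?T = "sheet c \<inter> (Ft \<inter> \<tau> -` sheet c)"
      have "openin (top_of_set Ft) ?T"
        by (rule openin_Int[OF openin_sheet[OF c'] openin_deck_vimage[OF openin_sheet[OF c']]])
      moreover have "a \<in> ?T" using True c(3) a by auto
      moreover have "\<tau> x = x" if "x \<in> ?T" for x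
        using inj_onD[OF inj_on_sheet[of c] deck_proj[of x]] that by simp
      ultimately show ?thesis using True by blast
    next
      case False
      let ?T = "sheet c \<inter> (Ft \<inter> \<tau> -` sheet (reflect c))"
      have "openin (top_of_set Ft) ?T"
        by (rule openin_Int[OF openin_sheet[OF c'] openin_deck_vimage[OF openin_sheet[OF reflect_charts[OF c']]]])
      moreover have "a \<in> ?T"
        using sheetI[OF deck_in[OF a] fibre_reflect[OF a deck_in[OF a] _ _ c(1)]] False c(3) a
          deck_proj[OF a] by auto
      moreover have "\<tau> x \<noteq> x" if "x \<in> ?T" for x
        using reflect_not_mem[OF ori_in, of x c] sheetD(2)[of x c] sheetD(2)[of "\<tau> x" "reflect c"] that
        by auto
      ultimately show ?thesis using False by blast
    qed
  qed auto
  with y0 show ?thesis by simp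
qed

lemma deck_reflect: "y \<in> Ft \<Longrightarrow> c \<in> ori y \<Longrightarrow> reflect c \<in> ori (\<tau> y)"
  using fibre_reflect[OF _ deck_in] deck_proj deck_moves by metis

text \<open>Applying \<tau> twice reflects twice, which leads back to the same sheet over the same
  point.\<close>

lemma deck_involution:
  assumes y: "y \<in> Ft"
  shows "\<tau> (\<tau> y) = y"
proof -
  obtain c where c: "c \<in> ori y" using ori_chart_exists[OF y] by blast
  have "c \<in> ori (\<tau> (\<tau> y))" using deck_reflect[OF deck_in[OF y] deck_reflect[OF y c]] by simp
  then have "\<tau> (\<tau> y) \<in> sheet c" by (intro sheetI deck_in y)
  moreover have "p (\<tau> (\<tau> y)) = p y" by (simp add: deck_proj deck_in y)
  ultimately show ?thesis using inj_onD[OF inj_on_sheet] sheetI[OF y c] by blast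
qed

lemma orientation_in: "y \<in> Ft \<Longrightarrow> \<mu> y \<in> local_orientations Ft y"
  using orientation by (auto simp: is_orientation_def)

lemma lift_sign_cong:
  assumes y: "y \<in> Ft" and c: "c \<in> ori y" "c' \<in> ori y" and d: "d \<in> \<mu> y" "d' \<in> \<mu> y"
    and sgn: "relative_sign Ft y (lift_chart c) d e"
  shows "relative_sign Ft y (lift_chart c') d' e"
proof -
  note C = lift_chart_charts_at[OF y c(1)] and C' = lift_chart_charts_at[OF y c(2)]
  note D = local_orientation_charts_at[OF orientation_in[OF y] d(1)]
    and D' = local_orientation_charts_at[OF orientation_in[OF y] d(2)]
  have "relative_sign Ft y (lift_chart c') d (1 * e)"
    by (rule relative_sign_trans[OF C' C D relative_sign_lift_chart[OF y c(2,1)] sgn])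
  moreover have "relative_sign Ft y d d' 1"
    using local_orientation_mem_iff[OF orientation_in[OF y] d(1)] d(2) by blast
  ultimately have "relative_sign Ft y (lift_chart c') d' (1 * e * 1)"
    by (rule relative_sign_trans[OF C' D D'])
  then show ?thesis by simp
qed

text \<open>Compares the tautological orientation with \<mu>. The charts \<open>c\<close> and
  \<open>d\<close> represent their orientations throughout a neighbourhood and their relative sign
  persists there, so the sign is locally constant, hence constant.\<close>

lemma lift_sign_exists:
  obtains e where "e \<in> {1, -1}"
    "\<And>y c d. \<lbrakk>y \<in> Ft; c \<in> ori y; d \<in> \<mu> y\<rbrakk> \<Longrightarrow> relative_sign Ft y (lift_chart c) d e"
proof -
  define P where "P y e \<longleftrightarrow> (\<forall>c\<in>ori y. \<forall>d\<in>\<mu> y. relative_sign Ft y (lift_chart c) d e)" for y e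
  have ex: "\<exists>e\<in>{1,-1}. P y e" if y: "y \<in> Ft" for y
  proof -
    obtain c where c: "c \<in> ori y" using ori_chart_exists[OF y] by blast
    obtain d where d: "d \<in> charts_at Ft y" "d \<in> \<mu> y" using local_orientationE[OF orientation_in[OF y]] by blast
    obtain e where "e \<in> {1, -1}" "relative_sign Ft y (lift_chart c) d e"
      using relative_sign_exists[OF lift_chart_charts_at[OF y c] d(1)] by blast
    then show ?thesis unfolding P_def using lift_sign_cong[OF y c _ d(2)] by blast
  qed
  have uniq: "e = e'" if y: "y \<in> Ft" and "P y e" "P y e'" for y e e'
  proof -
    obtain c where c: "c \<in> ori y" using ori_chart_exists[OF y] by blast
    obtain d where d: "d \<in> charts_at Ft y" "d \<in> \<mu> y" using local_orientationE[OF orientation_in[OF y]] by blast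
    show ?thesis
      using relative_sign_unique[OF lift_chart_charts_at[OF y c] d(1)] that c d(2) unfolding P_def by blast
  qed
  obtain y0 where y0: "y0 \<in> Ft" using nontrivial by blast
  obtain e0 where e0: "e0 \<in> {1, -1}" "P y0 e0" using ex[OF y0] by blast
  have "P y e0" if y: "y \<in> Ft" for y
  proof -
    have "\<exists>e. P y0 e \<and> P y e"
    proof (rule connected_equivalence_relation[OF connected_Ft y0 y])
      fix a b assume "\<exists>e. P a e \<and> P b e" then show "\<exists>e. P b e \<and> P a e" by blast
    next
      fix a b c assume "\<exists>e. P a e \<and> P b e" "\<exists>e. P b e \<and> P c e" "b \<in> Ft"
      then show "\<exists>e. P a e \<and> P c e" using uniq by metis
    next
      fix a assume a: "a \<in> Ft"
      obtain c where c: "c \<in> ori a" "c \<in> charts_at F (p a)" "a \<in> sheet c" using ori_chart_exists[OF a] by blast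
      obtain d where d: "d \<in> \<mu> a" "\<forall>y\<in>fst d. d \<in> \<mu> y"
        using orientation a unfolding is_orientation_def by fastforce
      have dc: "d \<in> charts_at Ft a" using local_orientation_charts_at[OF orientation_in[OF a] d(1)] .
      obtain e where e: "P a e" using ex[OF a] by blast
      then have "relative_sign Ft a (lift_chart c) d e" using c(1) d(1) unfolding P_def by blast
      then obtain W where W: "openin (top_of_set Ft) W" "a \<in> W"
        "\<And>y. y \<in> W \<Longrightarrow> relative_sign Ft y (lift_chart c) d e"
        using relative_sign_local by metis
      let ?T = "W \<inter> sheet c \<inter> fst d"
      have "openin (top_of_set Ft) ?T"
        using W(1) openin_sheet[OF charts_atD(1)[OF c(2)]] chartsD(1)[OF charts_atD(1)[OF dc]]
        by (intro openin_Int)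
      moreover have "a \<in> ?T" using W(2) c(3) charts_atD(2)[OF dc] by blast
      moreover have "P x e" if x: "x \<in> ?T" for x
      proof -
        have "x \<in> Ft" "c \<in> ori x" "d \<in> \<mu> x" using x sheetD d(2) by blast+
        then show ?thesis unfolding P_def using lift_sign_cong W(3) x by blast
      qed
      ultimately show "\<exists>T. openin (top_of_set Ft) T \<and> a \<in> T \<and> (\<forall>x\<in>T. \<exists>e. P a e \<and> P x e)"
        using e by blast
    qed
    then show ?thesis using uniq[OF y0 _ e0(2)] by blast
  qed
  with e0(1) show ?thesis using that unfolding P_def by blast
qed

lemma deck_homeomorphism: "homeomorphism Ft Ft \<tau> \<tau>"
proof -
  have "\<tau> ` Ft = Ft" using deck_in deck_involution by (metis image_subset_iff subsetI subset_antisym image_eqI)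
  then show ?thesis using deck_continuous deck_involution by (simp add: homeomorphism_def)
qed

text \<open>Since \<open>p\<close> is invariant under \<tau>, the chart \<open>lift_chart c\<close>
  transported to \<open>\<tau> q\<close> is the reflection of \<open>lift_chart (reflect c)\<close>.
  Transport keeps its sign \<open>e\<close> against \<open>d\<close>, whereas
  \<open>lift_chart (reflect c)\<close> itself already has sign \<open>e\<close> against \<mu>. So
  the transported \<open>d\<close> is negatively oriented and its reflection belongs to
  \<mu>.\<close>

lemma deck_reverses:
  assumes q: "q \<in> Ft" and d: "d \<in> \<mu> q"
  shows "(\<tau> ` fst d, \<lambda>y. - cnj (snd d (\<tau> y))) \<in> \<mu> (\<tau> q)"
proof -
  obtain e where e: "e \<in> {1, -1}"
    "\<And>y c d. \<lbrakk>y \<in> Ft; c \<in> ori y; d \<in> \<mu> y\<rbrakk> \<Longrightarrow> relative_sign Ft y (lift_chart c) d e"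
    using lift_sign_exists by blast
  note dc = local_orientation_charts_at[OF orientation_in[OF q] d] and q' = deck_in[OF q]
  note dc' = charts_atD(1)[OF dc]
  have dS: "fst d \<subseteq> Ft" by (rule chartsD(6)[OF dc'])
  let ?d = "(\<tau> ` fst d, \<lambda>y. snd d (\<tau> y))"
  have hom: "homeomorphism (\<tau> ` fst d) (fst d) \<tau> \<tau>"
    using dS deck_in deck_involution
    by (auto simp: homeomorphism_def image_image intro!: continuous_on_subset[OF deck_continuous])
       (metis (no_types, lifting) image_eqI subsetD)
  have "openin (top_of_set Ft) (\<tau> ` fst d)"
    by (rule homeomorphism_imp_open_map[OF deck_homeomorphism chartsD(1)[OF dc']])
  then have "?d \<in> charts Ft"
    by (rule charts_pullback[OF dc' _ chartsD(1)[OF dc'] subset_refl hom]) simp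
  then have pd: "?d \<in> charts_at Ft (\<tau> q)" using charts_atD(2)[OF dc] by (intro charts_atI) auto
  obtain c where c: "c \<in> ori q" using ori_chart_exists[OF q] by blast
  have rc: "reflect c \<in> ori (\<tau> q)" by (rule deck_reflect[OF q c])
  let ?l = "lift_chart (reflect c)"
  have l: "?l \<in> charts_at Ft (\<tau> q)" by (rule lift_chart_charts_at[OF q' rc])
  note rl = reflect_charts_at[OF l]
  have "relative_sign Ft (\<tau> q) (reflect ?l) ?d e"
  proof (rule relative_sign_pullback[where f = \<tau> and c = "lift_chart c" and d = d])
    show "relative_sign Ft (\<tau> (\<tau> q)) (lift_chart c) d e"
      using e(2)[OF q c d] deck_involution[OF q] by simp
    show "reflect ?l \<in> charts Ft" "?d \<in> charts Ft" using charts_atD rl pd by blast+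
    show "lift_chart c \<in> charts Ft" using charts_atD lift_chart_charts_at[OF q c] by blast
    show "\<tau> ` fst (reflect ?l) \<subseteq> fst (lift_chart c)"
    proof
      fix y assume "y \<in> \<tau> ` fst (reflect ?l)"
      then obtain w where w: "w \<in> sheet (reflect c)" "y = \<tau> w" by (auto simp: lift_chart_def)
      then have "c \<in> ori y" using deck_reflect[OF sheetD[OF w(1)]] by simp
      then show "y \<in> fst (lift_chart c)"
        using w sheetD(1) deck_in by (simp add: lift_chart_def sheetI)
    qed
    show "\<tau> ` fst ?d \<subseteq> fst d" using hom by (simp add: homeomorphism_def)
    show "\<And>w. w \<in> fst (reflect ?l) \<Longrightarrow> snd (reflect ?l) w = snd (lift_chart c) (\<tau> w)"
      using sheetD(1) deck_proj by (auto simp: lift_chart_def reflect_def)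
  qed (use deck_continuous deck_in q' in auto)
  then have 1: "relative_sign Ft (\<tau> q) ?d (reflect ?l) e" by (rule relative_sign_sym[OF rl pd])
  have 2: "relative_sign Ft (\<tau> q) (reflect ?l) ?l (- 1)"
    by (rule relative_sign_sym[OF l rl relative_sign_reflect[OF l]])
  have 3: "relative_sign Ft (\<tau> q) ?d ?l (e * - 1)" by (rule relative_sign_trans[OF pd rl l 1 2])
  have "?d \<notin> \<mu> (\<tau> q)"
  proof
    assume "?d \<in> \<mu> (\<tau> q)"
    then have "relative_sign Ft (\<tau> q) ?d ?l e" using relative_sign_sym[OF l pd] e(2)[OF q' rc] by blast
    then have "e = e * - 1" using relative_sign_unique[OF pd l] 3 by blast
    with e(1) show False by auto
  qed
  then have "reflect ?d \<in> \<mu> (\<tau> q)" using reflect_mem_iff[OF orientation_in[OF q'] pd] by blast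
  then show ?thesis by (simp add: reflect_def)
qed

end

section \<open>The Goldman bracket and orientation-reversing involutions\<close>

lemma extend_linear_superset:
  assumes "finite A" "Poly_Mapping.keys x \<subseteq> A"
  shows "extend_linear f x = (\<Sum>b\<in>A. fscale (Poly_Mapping.lookup x b) (f b))"
  unfolding extend_linear_def
proof (rule sum.mono_neutral_left[OF assms], intro ballI)
  fix b assume "b \<in> A - Poly_Mapping.keys x"
  then have "Poly_Mapping.lookup x b = 0" by (simp add: in_keys_iff)
  then show "fscale (Poly_Mapping.lookup x b) (f b) = 0" by (simp add: free_module.scale_zero_left)
qed

lemma extend_linear_hom: "module_hom fscale fscale (extend_linear f)"
proof (unfold_locales)
  fix x y :: "'b \<Rightarrow>\<^sub>0 'a" and r :: 'a
  let ?A = "Poly_Mapping.keys x \<union> Poly_Mapping.keys y"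
  have "Poly_Mapping.keys (x + y) \<subseteq> ?A" by (rule Poly_Mapping.keys_add)
  then show "extend_linear f (x + y) = extend_linear f x + extend_linear f y"
    using extend_linear_superset[of ?A "x + y" f] extend_linear_superset[of ?A x f] extend_linear_superset[of ?A y f]
    by (simp add: Poly_Mapping.lookup_add free_module.scale_left_distrib sum.distrib)
  have "Poly_Mapping.keys (fscale r x) \<subseteq> Poly_Mapping.keys x"
    by (auto simp: in_keys_iff lookup_fscale)
  then show "extend_linear f (fscale r x) = fscale r (extend_linear f x)"
    using extend_linear_superset[of "Poly_Mapping.keys x" "fscale r x" f]
    by (simp add: extend_linear_def lookup_fscale free_module.scale_sum_right free_module.scale_scale)
qed

lemma extend_linear_single: "extend_linear f (Poly_Mapping.single b 1) = f b"
  using extend_linear_superset[of "{b}" "Poly_Mapping.single b 1" f] by (simp add: free_module.scale_one)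

lemma extend_linear_cong:
  assumes "\<And>b. b \<in> Poly_Mapping.keys x \<Longrightarrow> f b = g b"
  shows "extend_linear f x = extend_linear g x"
  unfolding extend_linear_def using assms by (intro sum.cong) auto

lemma hom_extend_linear:
  assumes "module_hom fscale fscale L"
  shows "L (extend_linear f x) = extend_linear (\<lambda>b. L (f b)) x"
  unfolding extend_linear_def by (simp add: module_hom.sum[OF assms] module_hom.scale[OF assms])

lemma extend_linear_in_subspace:
  assumes "free_module.subspace N" "\<And>b. b \<in> Poly_Mapping.keys x \<Longrightarrow> f b \<in> N"
  shows "extend_linear f x \<in> N"
  unfolding extend_linear_def
  by (intro free_module.subspace_sum free_module.subspace_scale assms)

text \<open>A scalar from the second argument has to pass the coefficients of \<open>x\<close>,
  which uses commutativity of the ring.\<close>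

lemma extend_linear_fun_hom:
  "module_hom fscale fscale (\<lambda>y. extend_linear (\<lambda>a. extend_linear (B a) y) x)"
proof (unfold_locales)
  note h = extend_linear_hom
  show "extend_linear (\<lambda>a. extend_linear (B a) (y + y')) x
     = extend_linear (\<lambda>a. extend_linear (B a) y) x + extend_linear (\<lambda>a. extend_linear (B a) y') x" for y y'
    by (simp add: module_hom.add[OF h] extend_linear_def[where x = x] free_module.scale_right_distrib sum.distrib)
  show "extend_linear (\<lambda>a. extend_linear (B a) (fscale r y)) x
     = fscale r (extend_linear (\<lambda>a. extend_linear (B a) y) x)" for r y
    by (simp add: module_hom.scale[OF h] extend_linear_def[where x = x] free_module.scale_sum_right
         free_module.scale_scale mult.commute)
qed

lemma subspace_free_module_on: "free_module.subspace (free_module_on B)"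
  unfolding free_module.subspace_def free_module_on_def
  by (auto simp: in_keys_iff subset_iff lookup_fscale Poly_Mapping.lookup_add) (metis add.right_neutral mult_zero_right)+

lemma single_in_free_module_on: "b \<in> B \<Longrightarrow> Poly_Mapping.single b c \<in> free_module_on B"
  by (auto simp: free_module_on_def)

lemma goldman_bracket_hom_left: "module_hom fscale fscale (\<lambda>x. goldman_bracket S \<mu> x y)"
  unfolding goldman_bracket_def by (rule extend_linear_hom)

lemma goldman_bracket_hom_right: "module_hom fscale fscale (goldman_bracket S \<mu> x)"
  unfolding goldman_bracket_def by (rule extend_linear_fun_hom)

lemma push_hom: "module_hom fscale fscale (push S f)"
  unfolding push_def by (rule extend_linear_hom)

lemma theta_hom: "module_hom fscale fscale (theta \<iota> S \<tau>)"
  by unfold_locales (simp_all add: theta_def module_hom.add[OF push_hom] module_hom.scale[OF push_hom]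
      free_module.scale_right_distrib free_module.scale_right_diff_distrib algebra_simps
      free_module.scale_scale mult.commute)

section \<open>Free homotopy classes, based products and values of the bracket\<close>

lemma loopsD:
  assumes "a \<in> loops S"
  shows "path a" "path_image a \<subseteq> S" "pathfinish a = pathstart a"
  using assms by (auto simp: loops_def)

lemma free_class_iff: "\<delta> \<in> free_class S \<gamma> \<longleftrightarrow> homotopic_loops S \<gamma> \<delta>"
  by (simp add: free_class_def free_homotopy_def)

lemma free_class_loops: "\<delta> \<in> free_class S \<gamma> \<Longrightarrow> \<delta> \<in> loops S"
  unfolding free_class_iff loops_def
  using homotopic_loops_imp_path homotopic_loops_imp_subset homotopic_loops_imp_loop by blast

lemma free_class_eqI: "homotopic_loops S \<gamma> \<delta> \<Longrightarrow> free_class S \<gamma> = free_class S \<delta>"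
  unfolding set_eq_iff free_class_iff by (metis homotopic_loops_trans homotopic_loops_sym)

lemma pi_hatI: "\<gamma> \<in> loops S \<Longrightarrow> free_class S \<gamma> \<in> pi_hat S"
  by (auto simp: pi_hat_def free_class_def intro: quotientI)

lemma pi_hatE:
  assumes "\<alpha> \<in> pi_hat S"
  obtains \<gamma> where "\<gamma> \<in> loops S" "\<alpha> = free_class S \<gamma>"
  using assms unfolding pi_hat_def free_class_def by (rule quotientE)

lemma pi_hat_loops: "\<alpha> \<in> pi_hat S \<Longrightarrow> a \<in> \<alpha> \<Longrightarrow> a \<in> loops S"
  using pi_hatE free_class_loops by metis

lemma param_eqI:
  assumes "\<exists>!s. s \<in> {0..<1} \<and> a s = q"
  shows "param a q \<in> {0..<1}" "a (param a q) = q"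
  using theI'[OF assms] by (simp_all add: param_def)

lemma based_at_loop:
  assumes a: "a \<in> loops S" and q: "\<exists>!s. s \<in> {0..<1} \<and> a s = q"
  shows "based_at a q \<in> loops S" "pathstart (based_at a q) = q" "pathfinish (based_at a q) = q"
proof -
  have s: "param a q \<in> {0..1}" "a (param a q) = q" using param_eqI[OF q] by auto
  note a' = loopsD[OF a]
  show "pathstart (based_at a q) = q" "pathfinish (based_at a q) = q"
    using pathstart_shiftpath[of "param a q" a] closed_shiftpath[OF a'(3), of "param a q"] s
    by (auto simp: based_at_def)
  then show "based_at a q \<in> loops S"
    using path_shiftpath[OF a'(1,3) s(1)] path_image_shiftpath[OF s(1) a'(3)] a'(2)
    by (auto simp: based_at_def loops_def)
qed

lemma product_loop:
  assumes "a \<in> loops S" "\<exists>!s. s \<in> {0..<1} \<and> a s = q" "b \<in> loops S" "\<exists>!s. s \<in> {0..<1} \<and> b s = q"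
  shows "based_at a q +++ based_at b q \<in> loops S"
  using based_at_loop[OF assms(1,2)] based_at_loop[OF assms(3,4)]
  by (auto simp: loops_def path_image_join)

lemma goldman_sum_in:
  assumes "a \<in> loops S" "b \<in> loops S" "general_position \<mu> a b"
  shows "goldman_sum S \<mu> a b \<in> free_module_on (pi_hat S)"
  unfolding goldman_sum_def
proof (intro free_module.subspace_sum free_module.subspace_scale subspace_free_module_on single_in_free_module_on pi_hatI)
  fix q assume "q \<in> path_image a \<inter> path_image b"
  then show "based_at a q +++ based_at b q \<in> loops S"
    using assms(3) unfolding general_position_def by (intro product_loop assms(1,2)) blast+
qed

text \<open>The existence clause supplies a pair in general position, and its sum pins the
  value.\<close>

lemma is_goldman_value_unique:
  "is_goldman_value S \<mu> \<alpha> \<beta> z \<Longrightarrow> is_goldman_value S \<mu> \<alpha> \<beta> z' \<Longrightarrow> z = z'"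
  unfolding is_goldman_value_def by metis

lemma goldman_basis_eq: "is_goldman_value S \<mu> \<alpha> \<beta> z \<Longrightarrow> goldman_basis S \<mu> \<alpha> \<beta> = z"
  unfolding goldman_basis_def using is_goldman_value_unique by (auto intro!: the_equality)

lemma goldman_basis_in:
  assumes "\<alpha> \<in> pi_hat S" "\<beta> \<in> pi_hat S"
  shows "(goldman_basis S \<mu> \<alpha> \<beta> :: _ \<Rightarrow>\<^sub>0 'k::comm_ring_1) \<in> free_module_on (pi_hat S)"
proof (cases "\<exists>z :: _ \<Rightarrow>\<^sub>0 'k. is_goldman_value S \<mu> \<alpha> \<beta> z")
  case True
  then obtain z :: "_ \<Rightarrow>\<^sub>0 'k" where z: "is_goldman_value S \<mu> \<alpha> \<beta> z" by blast
  then obtain a b where ab: "a \<in> \<alpha>" "b \<in> \<beta>" "general_position \<mu> a b" "z = goldman_sum S \<mu> a b"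
    unfolding is_goldman_value_def by metis
  then have "z \<in> free_module_on (pi_hat S)" using goldman_sum_in pi_hat_loops assms by metis
  then show ?thesis using goldman_basis_eq[OF z] by simp
next
  case False
  then show ?thesis using free_module.subspace_0[OF subspace_free_module_on] by (simp add: goldman_basis_def)
qed

lemma goldman_bracket_in:
  assumes "x \<in> free_module_on (pi_hat S)" "y \<in> free_module_on (pi_hat S)"
  shows "goldman_bracket S \<mu> x y \<in> free_module_on (pi_hat S)"
  unfolding goldman_bracket_def
  by (intro extend_linear_in_subspace subspace_free_module_on goldman_basis_in)
     (use assms in \<open>auto simp: free_module_on_def\<close>)

section \<open>Loops and crossings under an orientation-reversing involution\<close>

locale reversing_involution =
  fixes S :: "'a::topological_space set" and \<mu> :: "'a \<Rightarrow> 'a local_orientation" and \<tau> :: "'a \<Rightarrow> 'a"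
  assumes cont: "continuous_on S \<tau>" and into: "\<And>y. y \<in> S \<Longrightarrow> \<tau> y \<in> S"
    and invol: "\<And>y. y \<in> S \<Longrightarrow> \<tau> (\<tau> y) = y"
    and chart_sub: "\<And>q c. \<lbrakk>q \<in> S; c \<in> \<mu> q\<rbrakk> \<Longrightarrow> fst c \<subseteq> S"
    and reverses: "\<And>q c. \<lbrakk>q \<in> S; c \<in> \<mu> q\<rbrakk> \<Longrightarrow> (\<tau> ` fst c, \<lambda>y. - cnj (snd c (\<tau> y))) \<in> \<mu> (\<tau> q)"
begin

text \<open>Only the restriction of a loop to \<open>{0..1}\<close> matters, and \<open>\<tau> \<circ> \<tau>\<close> is the identity only on \<open>S\<close>;
  in contrast to \<open>b = \<tau> \<circ> a\<close>, the following relation is therefore symmetric.\<close>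

definition twin :: "(real \<Rightarrow> 'a) \<Rightarrow> (real \<Rightarrow> 'a) \<Rightarrow> bool" where
  "twin a b \<longleftrightarrow> (\<forall>t\<in>{0..1}. a t \<in> S \<and> b t = \<tau> (a t))"

lemma twin_sym: "twin a b \<Longrightarrow> twin b a"
  by (auto simp: twin_def into invol)

lemma twin_comp: "a \<in> loops S \<Longrightarrow> twin a (\<tau> \<circ> a)"
  using loopsD(2) by (fastforce simp: twin_def path_image_def)

lemma involution_eq_iff: "x \<in> S \<Longrightarrow> y \<in> S \<Longrightarrow> \<tau> x = \<tau> y \<longleftrightarrow> x = y"
  using invol by metis

lemma twin_passes_iff: "twin a a' \<Longrightarrow> q \<in> S \<Longrightarrow> s \<in> {0..<1} \<and> a' s = \<tau> q \<longleftrightarrow> s \<in> {0..<1} \<and> a s = q"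
  using involution_eq_iff by (auto simp: twin_def)

lemma param_twin: "twin a a' \<Longrightarrow> q \<in> S \<Longrightarrow> param a' (\<tau> q) = param a q"
  unfolding param_def using twin_passes_iff by simp

text \<open>In the transported chart \<open>a'\<close> has the coordinates of \<open>a\<close>
  reflected by z -> - cnj z. This map is real linear, so a line stays a line and its velocity is
  reflected too.\<close>

lemma straight_at_twin:
  assumes a: "twin a a'" and s: "s \<in> {0..<1}" and U: "fst c \<subseteq> S" and st: "straight_at c a s v"
  shows "straight_at (\<tau> ` fst c, \<lambda>y. - cnj (snd c (\<tau> y))) a' s (- cnj v)"
proof -
  obtain \<delta> where \<delta>: "\<delta> > 0"
    "\<And>u. \<bar>u\<bar> < \<delta> \<Longrightarrow> a (frac (s + u)) \<in> fst c \<and> snd c (a (frac (s + u))) = snd c (a s) + of_real u * v"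
    using st by (auto simp: straight_at_def split: prod.splits)
  have t: "a' t = \<tau> (a t)" "\<tau> (a' t) = a t" if "t \<in> {0..1}" for t
    using a invol that by (auto simp: twin_def)
  have "a' (frac (s + u)) \<in> \<tau> ` fst c \<and>
     - cnj (snd c (\<tau> (a' (frac (s + u))))) = - cnj (snd c (\<tau> (a' s))) + of_real u * (- cnj v)" if "\<bar>u\<bar> < \<delta>" for u
  proof -
    \<comment> \<open>Near the base point \<open>s + u\<close> may leave the unit interval;
      \<open>frac\<close> returns it to where the twin relation holds.\<close>
    have "frac (s + u) \<in> {0..1}" using frac_lt_1[of "s + u"] by simp
    then show ?thesis using t[of s] t[of "frac (s + u)"] \<delta>(2)[OF that] s by (auto simp: algebra_simps)
  qed
  then show ?thesis using \<delta>(1) unfolding straight_at_def by auto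
qed

lemma crosses_twin:
  assumes a: "twin a a'" "\<exists>!s. s \<in> {0..<1} \<and> a s = q" and b: "twin b b'" "\<exists>!s. s \<in> {0..<1} \<and> b s = q"
    and q: "q \<in> S" and cr: "crosses \<mu> a b q e"
  shows "crosses \<mu> a' b' (\<tau> q) (- e)"
proof -
  obtain c v w where c: "c \<in> \<mu> q" "Im (snd c q) > 0"
    and st: "straight_at c a (param a q) v" "straight_at c b (param b q) w"
    and vw: "Im (cnj v * w) \<noteq> 0" "sgn (Im (cnj v * w)) = e"
    using cr by (auto simp: crosses_def)
  let ?c = "(\<tau> ` fst c, \<lambda>y. - cnj (snd c (\<tau> y)))"
  note sub = chart_sub[OF q c(1)]
  have st': "straight_at ?c a' (param a' (\<tau> q)) (- cnj v)" "straight_at ?c b' (param b' (\<tau> q)) (- cnj w)"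
    using straight_at_twin[OF a(1) param_eqI(1)[OF a(2)] sub st(1)]
      straight_at_twin[OF b(1) param_eqI(1)[OF b(2)] sub st(2)] param_twin[OF a(1) q] param_twin[OF b(1) q]
    by simp_all
  \<comment> \<open>The reflection has determinant -1; here the sign of the crossing
    changes.\<close>
  have im: "Im (cnj (- cnj v) * - cnj w) = - Im (cnj v * w)" by simp
  have vw': "Im (cnj (- cnj v) * - cnj w) \<noteq> 0" "sgn (Im (cnj (- cnj v) * - cnj w)) = - e"
    unfolding im sgn_minus vw(2) using vw(1) by simp_all
  have pos: "Im (- cnj (snd c (\<tau> (\<tau> q)))) > 0" using c(2) invol[OF q] by simp
  show ?thesis unfolding crosses_def
    by (rule bexI[OF _ reverses[OF q c(1)]], unfold prod.case) (use pos st' vw' in blast)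
qed

lemma twin_unique_iff:
  "twin a a' \<Longrightarrow> q \<in> S \<Longrightarrow> (\<exists>!s. s \<in> {0..<1} \<and> a' s = \<tau> q) \<longleftrightarrow> (\<exists>!s. s \<in> {0..<1} \<and> a s = q)"
  using twin_passes_iff by simp

lemma path_image_twin: "twin a a' \<Longrightarrow> path_image a' = \<tau> ` path_image a"
  unfolding path_image_def image_image by (intro image_cong) (auto simp: twin_def)

lemma path_image_sub: "twin a a' \<Longrightarrow> path_image a \<subseteq> S"
  by (auto simp: path_image_def twin_def)

lemma intersection_twin:
  assumes "twin a a'" "twin b b'"
  shows "path_image a' \<inter> path_image b' = \<tau> ` (path_image a \<inter> path_image b)"
  unfolding path_image_twin[OF assms(1)] path_image_twin[OF assms(2)]
  by (rule inj_on_image_Int[of \<tau> S, symmetric])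
     (use involution_eq_iff path_image_sub assms in \<open>auto simp: inj_on_def\<close>)

lemma general_position_twin:
  assumes a: "twin a a'" and b: "twin b b'" and gp: "general_position \<mu> a b"
  shows "general_position \<mu> a' b'"
  unfolding general_position_def intersection_twin[OF a b] ball_simps(9)
proof (intro conjI ballI)
  show "finite (\<tau> ` (path_image a \<inter> path_image b))" using gp by (simp add: general_position_def)
  fix q assume q: "q \<in> path_image a \<inter> path_image b"
  then have qS: "q \<in> S" using path_image_sub[OF a] by blast
  have u: "\<exists>!s. s \<in> {0..<1} \<and> a s = q" "\<exists>!s. s \<in> {0..<1} \<and> b s = q"
    and cr: "crosses \<mu> a b q 1 \<or> crosses \<mu> a b q (- 1)"
    using gp q unfolding general_position_def by blast+
  show "\<exists>!s. s \<in> {0..<1} \<and> a' s = \<tau> q" "\<exists>!s. s \<in> {0..<1} \<and> b' s = \<tau> q"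
    using twin_unique_iff[OF a qS, THEN iffD2, OF u(1)] twin_unique_iff[OF b qS, THEN iffD2, OF u(2)] .
  show "crosses \<mu> a' b' (\<tau> q) 1 \<or> crosses \<mu> a' b' (\<tau> q) (- 1)"
    using crosses_twin[OF a u(1) b u(2) qS] cr by force
qed

text \<open>The intersection number is a difference of two truth values, so an equivalence is
  required; its other half comes from the symmetry of \<open>twin\<close> and
  \<open>\<tau> (\<tau> q) = q\<close>.\<close>

lemma local_intersection_twin:
  assumes a: "twin a a'" "\<exists>!s. s \<in> {0..<1} \<and> a s = q" and b: "twin b b'" "\<exists>!s. s \<in> {0..<1} \<and> b s = q"
    and q: "q \<in> S"
  shows "local_intersection \<mu> a' b' (\<tau> q) = - local_intersection \<mu> a b q"
proof -
  have "crosses \<mu> a b q (- e)" if "crosses \<mu> a' b' (\<tau> q) e" for e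
    using crosses_twin[OF twin_sym[OF a(1)] twin_unique_iff[OF a(1) q, THEN iffD2, OF a(2)]
        twin_sym[OF b(1)] twin_unique_iff[OF b(1) q, THEN iffD2, OF b(2)] into[OF q] that]
    unfolding invol[OF q] .
  then have "crosses \<mu> a' b' (\<tau> q) e \<longleftrightarrow> crosses \<mu> a b q (- e)" for e
    using crosses_twin[OF a b q, of "- e"] by auto
  then show ?thesis by (simp add: local_intersection_def)
qed

lemma push_class_free_class:
  assumes \<gamma>: "\<gamma> \<in> loops S"
  shows "push_class S \<tau> (free_class S \<gamma>) = free_class S (\<tau> \<circ> \<gamma>)"
proof -
  have h: "homotopic_loops S (\<tau> \<circ> \<gamma>) (\<tau> \<circ> \<delta>)" if "homotopic_loops S \<gamma> \<delta>" for \<delta>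
    using homotopic_loops_continuous_image[OF that cont, of S] into by auto
  have g: "homotopic_loops S \<gamma> \<gamma>" using \<gamma> by (simp add: loops_def homotopic_loops_refl)
  show ?thesis
  proof (rule set_eqI)
    fix \<epsilon>
    have "\<epsilon> \<in> push_class S \<tau> (free_class S \<gamma>) \<longleftrightarrow> (\<exists>\<delta>. homotopic_loops S \<gamma> \<delta> \<and> homotopic_loops S (\<tau> \<circ> \<delta>) \<epsilon>)"
      by (auto simp: push_class_def free_homotopy_def free_class_iff)
    also have "\<dots> \<longleftrightarrow> homotopic_loops S (\<tau> \<circ> \<gamma>) \<epsilon>"
      using h g homotopic_loops_trans by blast
    finally show "\<epsilon> \<in> push_class S \<tau> (free_class S \<gamma>) \<longleftrightarrow> \<epsilon> \<in> free_class S (\<tau> \<circ> \<gamma>)"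
      by (simp add: free_class_iff)
  qed
qed

lemma comp_loops: "\<gamma> \<in> loops S \<Longrightarrow> \<tau> \<circ> \<gamma> \<in> loops S"
  using into unfolding loops_def
  by (auto simp: pathfinish_compose pathstart_compose path_image_compose
      intro!: path_continuous_image continuous_on_subset[OF cont])

text \<open>A twin agrees with \<open>\<tau> \<circ> \<gamma>\<close> on \<open>{0..1}\<close> only,
  which is enough for equality of classes though not of functions.\<close>

lemma free_class_twin:
  assumes "\<gamma> \<in> loops S" "twin \<gamma> \<gamma>'"
  shows "free_class S \<gamma>' = push_class S \<tau> (free_class S \<gamma>)"
proof -
  have "homotopic_loops S (\<tau> \<circ> \<gamma>) \<gamma>'"
    using loopsD[OF comp_loops[OF assms(1)]] assms(2)
    by (intro homotopic_loops_eq) (auto simp: twin_def)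
  then show ?thesis unfolding push_class_free_class[OF assms(1)] by (rule free_class_eqI[symmetric])
qed

lemma push_class_in: "\<alpha> \<in> pi_hat S \<Longrightarrow> push_class S \<tau> \<alpha> \<in> pi_hat S"
  by (metis comp_loops pi_hatE pi_hatI push_class_free_class)

lemma push_class_invol:
  assumes "\<alpha> \<in> pi_hat S"
  shows "push_class S \<tau> (push_class S \<tau> \<alpha>) = \<alpha>"
proof -
  obtain \<gamma> where \<gamma>: "\<gamma> \<in> loops S" "\<alpha> = free_class S \<gamma>" using assms by (rule pi_hatE)
  have "free_class S \<gamma> = push_class S \<tau> (free_class S (\<tau> \<circ> \<gamma>))"
    by (rule free_class_twin[OF comp_loops[OF \<gamma>(1)] twin_sym[OF twin_comp[OF \<gamma>(1)]]])
  moreover have "push_class S \<tau> \<alpha> = free_class S (\<tau> \<circ> \<gamma>)"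
    unfolding \<gamma>(2) by (rule push_class_free_class[OF \<gamma>(1)])
  ultimately show ?thesis using \<gamma>(2) by simp
qed

lemma comp_in_push_class:
  assumes "\<alpha> \<in> pi_hat S" "a \<in> \<alpha>"
  shows "\<tau> \<circ> a \<in> push_class S \<tau> \<alpha>"
proof -
  have "\<tau> \<circ> a \<in> loops S" using comp_loops pi_hat_loops assms by blast
  then have "homotopic_loops S (\<tau> \<circ> a) (\<tau> \<circ> a)" by (simp add: loops_def homotopic_loops_refl)
  then show ?thesis using assms(2) by (auto simp: push_class_def free_homotopy_def)
qed

text \<open>Twins pass through \<open>q\<close> and \<open>\<tau> q\<close> at the same parameter,
  so shifting and joining commute with \<tau> on the unit interval.\<close>

lemma twin_product:
  assumes a: "twin a a'" "\<exists>!s. s \<in> {0..<1} \<and> a s = q" and b: "twin b b'" "\<exists>!s. s \<in> {0..<1} \<and> b s = q"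
    and q: "q \<in> S"
  shows "twin (based_at a q +++ based_at b q) (based_at a' (\<tau> q) +++ based_at b' (\<tau> q))"
proof -
  have "twin (based_at a q) (based_at a' (\<tau> q))" if "twin a a'" "\<exists>!s. s \<in> {0..<1} \<and> a s = q" for a a'
    using that(1) param_eqI(1)[OF that(2)] unfolding based_at_def param_twin[OF that(1) q]
    by (auto simp: twin_def shiftpath_def)
  from this[OF a] this[OF b] show ?thesis by (auto simp: twin_def joinpaths_def)
qed

text \<open>\<tau> is a bijection between the intersection points; at each one the loop product is
  carried along and the sign flips.\<close>

lemma goldman_sum_twin:
  assumes a: "a \<in> loops S" "twin a a'" and b: "b \<in> loops S" "twin b b'" and gp: "general_position \<mu> a b"
  shows "goldman_sum S \<mu> a' b' = - push S \<tau> (goldman_sum S \<mu> a b)"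
proof -
  let ?I = "path_image a \<inter> path_image b"
  let ?g = "\<lambda>a b q. fscale (of_int (local_intersection \<mu> a b q))
              (Poly_Mapping.single (free_class S (based_at a q +++ based_at b q)) 1)"
  have IS: "?I \<subseteq> S" using path_image_sub[OF a(2)] by blast
  have "inj_on \<tau> ?I" using IS involution_eq_iff by (auto simp: inj_on_def)
  then have "goldman_sum S \<mu> a' b' = (\<Sum>q\<in>?I. ?g a' b' (\<tau> q))"
    unfolding goldman_sum_def intersection_twin[OF a(2) b(2)] by (simp add: sum.reindex)
  also have "\<dots> = (\<Sum>q\<in>?I. - push S \<tau> (?g a b q))"
  proof (rule sum.cong[OF refl])
    fix q assume qI: "q \<in> ?I"
    then have q: "q \<in> S" using IS by blast
    have u: "\<exists>!s. s \<in> {0..<1} \<and> a s = q" "\<exists>!s. s \<in> {0..<1} \<and> b s = q"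
      using gp qI unfolding general_position_def by blast+
    have "free_class S (based_at a' (\<tau> q) +++ based_at b' (\<tau> q)) = push_class S \<tau> (free_class S (based_at a q +++ based_at b q))"
      using product_loop[OF a(1) u(1) b(1) u(2)] twin_product[OF a(2) u(1) b(2) u(2) q] by (rule free_class_twin)
    moreover have "local_intersection \<mu> a' b' (\<tau> q) = - local_intersection \<mu> a b q"
      by (rule local_intersection_twin[OF a(2) u(1) b(2) u(2) q])
    ultimately show "?g a' b' (\<tau> q) = - push S \<tau> (?g a b q)"
      unfolding module_hom.scale[OF push_hom] by (simp add: push_def extend_linear_single free_module.scale_minus_left)
  qed
  also have "\<dots> = - push S \<tau> (\<Sum>q\<in>?I. ?g a b q)"
    by (simp add: module_hom.sum[OF push_hom] sum_negf)
  finally show ?thesis by (simp add: goldman_sum_def)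
qed

text \<open>Every pair of representatives of the image classes is a twin of a pair representing the
  original classes, namely its own image under \<tau>. Thus the universal clause is transferred and
  not only the existential one.\<close>

lemma is_goldman_value_push:
  fixes z :: "(real \<Rightarrow> 'a) set \<Rightarrow>\<^sub>0 'k::comm_ring_1"
  assumes \<alpha>: "\<alpha> \<in> pi_hat S" and \<beta>: "\<beta> \<in> pi_hat S" and z: "is_goldman_value S \<mu> \<alpha> \<beta> z"
  shows "is_goldman_value S \<mu> (push_class S \<tau> \<alpha>) (push_class S \<tau> \<beta>) (- push S \<tau> z)"
  unfolding is_goldman_value_def
proof (intro conjI ballI impI)
  obtain a b where ab: "a \<in> \<alpha>" "b \<in> \<beta>" "general_position \<mu> a b"
    using z unfolding is_goldman_value_def by blast
  have "general_position \<mu> (\<tau> \<circ> a) (\<tau> \<circ> b)"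
    using general_position_twin[OF twin_comp twin_comp ab(3)] pi_hat_loops \<alpha> \<beta> ab(1,2) by blast
  then show "\<exists>a\<in>push_class S \<tau> \<alpha>. \<exists>b\<in>push_class S \<tau> \<beta>. general_position \<mu> a b"
    using comp_in_push_class \<alpha> \<beta> ab(1,2) by blast
next
  fix a b assume a: "a \<in> push_class S \<tau> \<alpha>" and b: "b \<in> push_class S \<tau> \<beta>" and gp: "general_position \<mu> a b"
  note al = pi_hat_loops[OF push_class_in[OF \<alpha>] a] and bl = pi_hat_loops[OF push_class_in[OF \<beta>] b]
  note ta = twin_comp[OF al] and tb = twin_comp[OF bl]
  have "\<tau> \<circ> a \<in> \<alpha>" "\<tau> \<circ> b \<in> \<beta>"
    using comp_in_push_class[OF push_class_in[OF \<alpha>] a] comp_in_push_class[OF push_class_in[OF \<beta>] b]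
      push_class_invol \<alpha> \<beta> by auto
  moreover have gp': "general_position \<mu> (\<tau> \<circ> a) (\<tau> \<circ> b)" by (rule general_position_twin[OF ta tb gp])
  ultimately have "goldman_sum S \<mu> (\<tau> \<circ> a) (\<tau> \<circ> b) = z"
    using z unfolding is_goldman_value_def by blast
  moreover have "(goldman_sum S \<mu> a b :: _ \<Rightarrow>\<^sub>0 'k) = - push S \<tau> (goldman_sum S \<mu> (\<tau> \<circ> a) (\<tau> \<circ> b))"
    by (rule goldman_sum_twin[OF comp_loops[OF al] twin_sym[OF ta] comp_loops[OF bl] twin_sym[OF tb] gp'])
  ultimately show "goldman_sum S \<mu> a b = - push S \<tau> z" by simp
qed

lemma goldman_basis_push:
  assumes \<alpha>: "\<alpha> \<in> pi_hat S" and \<beta>: "\<beta> \<in> pi_hat S"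
  shows "goldman_basis S \<mu> (push_class S \<tau> \<alpha>) (push_class S \<tau> \<beta>)
    = - push S \<tau> (goldman_basis S \<mu> \<alpha> \<beta> :: _ \<Rightarrow>\<^sub>0 'k::comm_ring_1)"
proof (cases "\<exists>z :: _ \<Rightarrow>\<^sub>0 'k. is_goldman_value S \<mu> \<alpha> \<beta> z")
  case True
  then obtain z :: "_ \<Rightarrow>\<^sub>0 'k" where z: "is_goldman_value S \<mu> \<alpha> \<beta> z" by blast
  show ?thesis
    using goldman_basis_eq[OF z] goldman_basis_eq[OF is_goldman_value_push[OF \<alpha> \<beta> z]] by simp
next
  case False
  \<comment> \<open>A value for the image pair could be transported back by \<tau>, so the default 0
    occurs on both sides together.\<close>
  have "\<nexists>z :: _ \<Rightarrow>\<^sub>0 'k. is_goldman_value S \<mu> (push_class S \<tau> \<alpha>) (push_class S \<tau> \<beta>) z"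
    using False is_goldman_value_push[OF push_class_in[OF \<alpha>] push_class_in[OF \<beta>]]
    unfolding push_class_invol[OF \<alpha>] push_class_invol[OF \<beta>] by blast
  with False show ?thesis by (simp add: goldman_basis_def module_hom.zero[OF push_hom])
qed

section \<open>Equivariance of the bracket and the image of theta\<close>

lemma push_in:
  assumes "x \<in> free_module_on (pi_hat S)"
  shows "push S \<tau> x \<in> free_module_on (pi_hat S)"
  unfolding push_def
  by (intro extend_linear_in_subspace subspace_free_module_on single_in_free_module_on push_class_in)
     (use assms in \<open>auto simp: free_module_on_def\<close>)

lemma push_push:
  assumes "x \<in> free_module_on (pi_hat S)"
  shows "push S \<tau> (push S \<tau> x) = x"
proof -
  have "push S \<tau> (push S \<tau> x) = extend_linear (\<lambda>\<alpha>. push S \<tau> (Poly_Mapping.single (push_class S \<tau> \<alpha>) 1)) x"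
    by (subst (2) push_def) (rule hom_extend_linear[OF push_hom])
  also have "\<dots> = extend_linear (\<lambda>\<alpha>. Poly_Mapping.single \<alpha> 1) x"
    using assms by (intro extend_linear_cong)
      (auto simp: push_def extend_linear_single push_class_invol free_module_on_def)
  also have "\<dots> = (\<Sum>\<alpha>\<in>Poly_Mapping.keys x. Poly_Mapping.single \<alpha> (Poly_Mapping.lookup x \<alpha>))"
    unfolding extend_linear_def
    by (intro sum.cong refl poly_mapping_eqI) (simp add: lookup_fscale lookup_single when_def)
  also have "\<dots> = x"
    by (rule poly_mapping_eqI) (simp add: lookup_sum lookup_single when_def in_keys_iff)
  finally show ?thesis .
qed

lemma goldman_bracket_push:
  assumes x: "x \<in> free_module_on (pi_hat S)" and y: "y \<in> free_module_on (pi_hat S)"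
  shows "goldman_bracket S \<mu> (push S \<tau> x) (push S \<tau> y) = - push S \<tau> (goldman_bracket S \<mu> x y)"
proof -
  let ?t = "push_class S \<tau>" and ?B = "goldman_basis S \<mu>"
  \<comment> \<open>Pushing an argument forward amounts to relabelling the basis elements inside the
    linear extension.\<close>
  have expand: "extend_linear f (push S \<tau> w) = extend_linear (\<lambda>\<alpha>. f (?t \<alpha>)) w" for f w
    unfolding push_def hom_extend_linear[OF extend_linear_hom] extend_linear_single ..
  have neg: "module_hom fscale fscale (\<lambda>z. - push S \<tau> z)"
    by unfold_locales (simp_all add: module_hom.add[OF push_hom] module_hom.scale[OF push_hom])
  have "goldman_bracket S \<mu> (push S \<tau> x) (push S \<tau> y)
      = extend_linear (\<lambda>\<alpha>. extend_linear (\<lambda>\<beta>. ?B (?t \<alpha>) (?t \<beta>)) y) x"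
    unfolding goldman_bracket_def expand ..
  also have "\<dots> = extend_linear (\<lambda>\<alpha>. extend_linear (\<lambda>\<beta>. - push S \<tau> (?B \<alpha> \<beta>)) y) x"
    using x y by (intro extend_linear_cong goldman_basis_push) (auto simp: free_module_on_def)
  also have "\<dots> = - push S \<tau> (goldman_bracket S \<mu> x y)"
    unfolding goldman_bracket_def hom_extend_linear[OF neg] ..
  finally show ?thesis .
qed

lemma lie_subalgebra_theta:
  "lie_subalgebra (goldman_bracket S \<mu>) (free_module_on (pi_hat S)) (theta \<iota> S \<tau> ` free_module_on (pi_hat S))"
  unfolding lie_subalgebra_def
proof (intro conjI ballI)
  let ?M = "free_module_on (pi_hat S)" and ?t = "push S \<tau>" and ?br = "goldman_bracket S \<mu>"
  note sub = subspace_free_module_on[of "pi_hat S"]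
  show "theta \<iota> S \<tau> ` ?M \<subseteq> ?M"
    by (auto simp: theta_def intro!: free_module.subspace_scale free_module.subspace_diff sub push_in)
  show "free_module.subspace (theta \<iota> S \<tau> ` ?M)"
    by (rule module_hom.subspace_image[OF theta_hom sub])
  fix u v assume "u \<in> theta \<iota> S \<tau> ` ?M" "v \<in> theta \<iota> S \<tau> ` ?M"
  then obtain x y where x: "x \<in> ?M" "u = theta \<iota> S \<tau> x" and y: "y \<in> ?M" "v = theta \<iota> S \<tau> y" by blast
  note l = goldman_bracket_hom_left[of S \<mu>] and r = goldman_bracket_hom_right[of S \<mu>]
  note t = push_hom[of S \<tau>]
  let ?k = "\<iota> (1 / 2)"
  \<comment> \<open>The bracket of two elements of the image carries two factors \<open>?k\<close>.
    One is absorbed by \<open>theta\<close>, the other remains in the preimage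
    \<open>fscale ?k ?w\<close>.\<close>
  let ?w = "?br x y - ?br x (?t y)"
  have 1: "?br (?t x) (?t y) = - ?t (?br x y)" by (rule goldman_bracket_push[OF x(1) y(1)])
  \<comment> \<open>The sign rule applied to \<open>x\<close> and \<open>?t y\<close>, with
    \<open>?t (?t y) = y\<close>.\<close>
  have 2: "?br (?t x) y = - ?t (?br x (?t y))"
    using goldman_bracket_push[OF x(1) push_in[OF y(1)]] push_push[OF y(1)] by simp
  have "?br u v = fscale ?k (fscale ?k (?br (x - ?t x) (y - ?t y)))"
    unfolding x(2) y(2) theta_def module_hom.scale[OF l] module_hom.scale[OF r] ..
  also have "?br (x - ?t x) (y - ?t y) = ?w - ?t ?w"
    unfolding module_hom.diff[OF l] module_hom.diff[OF r] module_hom.diff[OF t] 1 2 by simp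
  also have "fscale ?k (fscale ?k (?w - ?t ?w)) = theta \<iota> S \<tau> (fscale ?k ?w)"
    by (simp only: theta_def module_hom.scale[OF t] module_hom.diff[OF t] free_module.scale_right_diff_distrib)
  finally have "?br u v = theta \<iota> S \<tau> (fscale ?k ?w)" .
  moreover have "fscale ?k ?w \<in> ?M"
    by (intro free_module.subspace_scale free_module.subspace_diff sub goldman_bracket_in push_in x(1) y(1))
  ultimately show "?br u v \<in> theta \<iota> S \<tau> ` ?M" by blast
qed

end

theorem lemma2p6:
  fixes F :: "'a::topological_space set"
    and Ft :: "'b::topological_space set"
    and p :: "'b \<Rightarrow> 'a"
    and \<tau> :: "'b \<Rightarrow> 'b"
    and \<mu> :: "'b \<Rightarrow> 'b local_orientation"
    and \<iota> :: "rat \<Rightarrow> 'k::comm_ring_1"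
  assumes "rat_embedding \<iota>"
    and "surface F" and "compact F" and "connected F"
    and "surface_boundary F \<noteq> {}"
    and "\<not> orientable F"
    and "orientation_cover Ft p F"
    and "covering_transformation Ft p \<tau>" and "\<exists>y\<in>Ft. \<tau> y \<noteq> y"
    and "is_orientation Ft \<mu>"
  shows "lie_subalgebra (goldman_bracket Ft \<mu>) (free_module_on (pi_hat Ft))
           (theta \<iota> Ft \<tau> ` free_module_on (pi_hat Ft))"
proof -
  obtain ori where ori: "bij_betw (\<lambda>y. (p y, ori y)) Ft (SIGMA x:F. local_orientations F x)"
    "\<forall>(U, \<phi>)\<in>charts F. openin (top_of_set Ft) {y \<in> Ft. (U, \<phi>) \<in> ori y}"
    and cov: "covering_space Ft p F"
    using assms(7) unfolding orientation_cover_def by blast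
  interpret oriented_sheets Ft p F ori
  proof
    show "\<exists>c\<in>charts F. x \<in> fst c" if "x \<in> F" for x
      using assms(2) that unfolding surface_def split_def by blast
  qed (use ori cov in auto)
  \<comment> \<open>Non-orientability and connectedness of \<open>F\<close> enter here, through the
    connectedness of \<open>Ft\<close>.\<close>
  interpret oriented_sheets_involution Ft p F ori \<tau> \<mu>
    by unfold_locales (rule connected_cover[OF assms(4,6)] assms)+
  interpret reversing_involution Ft \<mu> \<tau>
  proof
    show "fst c \<subseteq> Ft" if "q \<in> Ft" "c \<in> \<mu> q" for q c
      using chartsD(6)[OF charts_atD(1)[OF local_orientation_charts_at[OF orientation_in[OF that(1)] that(2)]]] .
  qed (fact deck_continuous deck_in deck_involution deck_reverses)+
  show ?thesis by (rule lie_subalgebra_theta)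
qed


end
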